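(* For every matroid $M$, the foundation $F_M$ of $M$ is generated by the universal cross-ratios of $M$.
   Context: **Pastures.** A pointed group is a multiplicatively written commutative monoid $P$ with neutral element $1$ and absorbing element $0\ne1$ in which every nonzero element is invertible; $P^\times=P\setminus\{0\}$. In $\mathrm{Sym}^3(P)=P^3/S_3$ write $a+b+c$ for the class of $(a,b,c)$, $a+b$ for $a+b+0$ and $a$ for $a+0+0$. A pasture is a pointed group $P$ with a subset $N_P\subseteq\mathrm{Sym}^3(P)$ (the null set) that is invariant under multiplication by elements of $P$ and such that for every $a\in P$ there is a unique $b\in P$, denoted $-a$, with $a+b\in N_P$. A pasture morphism $g:P\to Q$ is a multiplicative map preserving $0$ and $1$ with $g(a)+g(b)+g(c)\in N_Q$ whenever $a+b+c\in N_P$. A subset $S\subseteq P^\times$ generates $P$ if $S\cup\{-1\}$ generates $P^\times$ as a group. **Representations and foundation.** Let $M$ be a matroid on a finite set $E$ with set of hyperplanes $\mathcal H$. A $P$-representation of $M$ is a family $\varphi=(\varphi_H:E\to P)_{H\in\mathcal H}$ with $\varphi_H(e)=0$ iff $e\in H$, such that for all distinct hyperplanes $H_1,H_2,H_3$ whose intersection is a corank $2$ flat there is $(a,b,c)\in P^3\setminus\{(0,0,0)\}$ with $a\varphi_{H_1}(e)+b\varphi_{H_2}(e)+c\varphi_{H_3}(e)\in N_P$ for all $e\in E$. Two representations $\varphi,\varphi'$ are rescaling equivalent if $\varphi'_H(e)=a_Ht_e\varphi_H(e)$ for some $(a_H)\in(P^\times)^{\mathcal H}$, $(t_e)\in(P^\times)^E$.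 $\mathrm R_M(P)$ is the set of rescaling classes of $P$-representations of $M$, a functor in $P$ by composing hyperplane functions with morphisms. The foundation $F_M$ is the pasture representing this functor: $\mathrm R_M(P)=\mathrm{Hom}(F_M,P)$ functorially in $P$ (it exists and is unique up to unique isomorphism). A universal representation $\varphi_{\mathrm{univ}}$ is an $F_M$-representation of $M$ whose rescaling class corresponds to $\mathrm{id}_{F_M}$. **Universal cross-ratios.** Let $\Theta_M$ be the set of $4$-tuples of hyperplanes $(H_1,H_2,H_3,H_4)$ such that $L=H_1\cap H_2\cap H_3\cap H_4$ is a corank $2$ flat and $L=H_i\cap H_j$ for all $i\in\{1,2\}$, $j\in\{3,4\}$. For $(H_1,H_2,H_3,H_4)\in\Theta_M$, choose $a\in H_3-L$ and $b\in H_4-L$; the universal cross-ratio of this tuple is $$\begin{bmatrix}H_1&H_2\\H_3&H_4\end{bmatrix}=\frac{\varphi_{\mathrm{univ},H_1}(a)\,\varphi_{\mathrm{univ},H_2}(b)}{\varphi_{\mathrm{univ},H_1}(b)\,\varphi_{\mathrm{univ},H_2}(a)}\in F_M^\times,$$ which is independent of the choices of $a$, $b$ and $\varphi_{\mathrm{univ}}$. *)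

theory Defs
  imports "HOL-Algebra.Generated_Groups" "HOL-Library.Multiset" "HOL-Library.FuncSet"
begin

section \<open>Pastures\<close>

text \<open>
  An element \<open>a + b + c\<close> of \<open>Sym\<^sup>3(P) = P\<^sup>3/S\<^sub>3\<close> is the multiset \<open>{#a, b, c#}\<close>;
  \<open>a + b\<close> abbreviates \<open>a + b + 0\<close>.
\<close>

record 'a pasture = "'a monoid" +
  pzero :: 'a
  null_set :: "'a multiset set"

definition Sym3 :: "'a pasture \<Rightarrow> 'a multiset set" where
  "Sym3 P = {m. size m = 3 \<and> set_mset m \<subseteq> carrier P}"

definition nonzeros :: "'a pasture \<Rightarrow> 'a set" where
  "nonzeros P = carrier P - {pzero P}"

definition pointed_group :: "'a pasture \<Rightarrow> bool" where
  "pointed_group P \<longleftrightarrow>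
     comm_monoid P \<and>
     pzero P \<in> carrier P \<and>
     pzero P \<noteq> \<one>\<^bsub>P\<^esub> \<and>
     (\<forall>x\<in>carrier P. pzero P \<otimes>\<^bsub>P\<^esub> x = pzero P) \<and>
     nonzeros P \<subseteq> Units P"

definition pasture :: "'a pasture \<Rightarrow> bool" where
  "pasture P \<longleftrightarrow>
     pointed_group P \<and>
     null_set P \<subseteq> Sym3 P \<and>
     (\<forall>x\<in>carrier P. \<forall>m\<in>null_set P. image_mset (\<lambda>y. x \<otimes>\<^bsub>P\<^esub> y) m \<in> null_set P) \<and>
     (\<forall>a\<in>carrier P. \<exists>!b. b \<in> carrier P \<and> {#a, b, pzero P#} \<in> null_set P)"

definition pneg :: "'a pasture \<Rightarrow> 'a \<Rightarrow> 'a" where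
  "pneg P a = (THE b. b \<in> carrier P \<and> {#a, b, pzero P#} \<in> null_set P)"

text \<open>
  Morphisms are extensional (\<open>undefined\<close> outside the carrier), so that two of them are equal
  as soon as they agree on the carrier.
\<close>

definition pasture_hom :: "'a pasture \<Rightarrow> 'b pasture \<Rightarrow> ('a \<Rightarrow> 'b) set" where
  "pasture_hom P Q = {g \<in> carrier P \<rightarrow>\<^sub>E carrier Q.
     g (pzero P) = pzero Q \<and>
     g \<one>\<^bsub>P\<^esub> = \<one>\<^bsub>Q\<^esub> \<and>
     (\<forall>x\<in>carrier P. \<forall>y\<in>carrier P. g (x \<otimes>\<^bsub>P\<^esub> y) = g x \<otimes>\<^bsub>Q\<^esub> g y) \<and>
     (\<forall>a\<in>carrier P. \<forall>b\<in>carrier P. \<forall>c\<in>carrier P.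
        {#a, b, c#} \<in> null_set P \<longrightarrow> {#g a, g b, g c#} \<in> null_set Q)}"

definition pasture_generated_by :: "'a pasture \<Rightarrow> 'a set \<Rightarrow> bool" where
  "pasture_generated_by P S \<longleftrightarrow>
     S \<subseteq> nonzeros P \<and>
     generate (units_of P) (S \<union> {pneg P \<one>\<^bsub>P\<^esub>}) = nonzeros P"


section \<open>Matroids\<close>

record 'e matroid =
  ground :: "'e set"
  indeps :: "'e set set"

definition matroid :: "'e matroid \<Rightarrow> bool" where
  "matroid M \<longleftrightarrow>
     finite (ground M) \<and>
     indeps M \<subseteq> Pow (ground M) \<and>
     {} \<in> indeps M \<and>
     (\<forall>I\<in>indeps M. \<forall>J. J \<subseteq> I \<longrightarrow> J \<in> indeps M) \<and>
     (\<forall>I\<in>indeps M. \<forall>J\<in>indeps M. card I < card J \<longrightarrow> (\<exists>x\<in>J - I. insert x I \<in> indeps M))"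

definition mrank :: "'e matroid \<Rightarrow> 'e set \<Rightarrow> nat" where
  "mrank M A = Max (card ` {I \<in> indeps M. I \<subseteq> A})"

definition flats :: "'e matroid \<Rightarrow> 'e set set" where
  "flats M = {A. A \<subseteq> ground M \<and> (\<forall>e\<in>ground M - A. mrank M A < mrank M (insert e A))}"

definition corank_flats :: "'e matroid \<Rightarrow> nat \<Rightarrow> 'e set set" where
  "corank_flats M k = {A \<in> flats M. mrank M A + k = mrank M (ground M)}"

definition hyperplanes :: "'e matroid \<Rightarrow> 'e set set" where
  "hyperplanes M = corank_flats M 1"


section \<open>Representations and rescaling classes\<close>

text \<open>A family \<open>(\<phi>\<^sub>H : E \<rightarrow> P)\<close> indexed by hyperplanes is extensional in both \<open>H\<close> and \<open>e\<close>.\<close>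

definition representations :: "'e matroid \<Rightarrow> 'a pasture \<Rightarrow> ('e set \<Rightarrow> 'e \<Rightarrow> 'a) set" where
  "representations M P = {\<phi> \<in> hyperplanes M \<rightarrow>\<^sub>E (ground M \<rightarrow>\<^sub>E carrier P).
     (\<forall>H\<in>hyperplanes M. \<forall>e\<in>ground M. \<phi> H e = pzero P \<longleftrightarrow> e \<in> H) \<and>
     (\<forall>H1\<in>hyperplanes M. \<forall>H2\<in>hyperplanes M. \<forall>H3\<in>hyperplanes M.
        H1 \<noteq> H2 \<and> H1 \<noteq> H3 \<and> H2 \<noteq> H3 \<and> H1 \<inter> H2 \<inter> H3 \<in> corank_flats M 2 \<longrightarrow>
        (\<exists>a\<in>carrier P. \<exists>b\<in>carrier P. \<exists>c\<in>carrier P.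
           (a, b, c) \<noteq> (pzero P, pzero P, pzero P) \<and>
           (\<forall>e\<in>ground M.
              {#a \<otimes>\<^bsub>P\<^esub> \<phi> H1 e, b \<otimes>\<^bsub>P\<^esub> \<phi> H2 e, c \<otimes>\<^bsub>P\<^esub> \<phi> H3 e#} \<in> null_set P)))}"

definition rescaling_rel ::
    "'e matroid \<Rightarrow> 'a pasture \<Rightarrow> (('e set \<Rightarrow> 'e \<Rightarrow> 'a) \<times> ('e set \<Rightarrow> 'e \<Rightarrow> 'a)) set" where
  "rescaling_rel M P = {(\<phi>, \<phi>'). \<phi> \<in> representations M P \<and> \<phi>' \<in> representations M P \<and>
     (\<exists>a\<in>hyperplanes M \<rightarrow> nonzeros P. \<exists>t\<in>ground M \<rightarrow> nonzeros P.
        \<forall>H\<in>hyperplanes M. \<forall>e\<in>ground M. \<phi>' H e = a H \<otimes>\<^bsub>P\<^esub> t e \<otimes>\<^bsub>P\<^esub> \<phi> H e)}"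

definition rescaling_classes :: "'e matroid \<Rightarrow> 'a pasture \<Rightarrow> ('e set \<Rightarrow> 'e \<Rightarrow> 'a) set set" where
  "rescaling_classes M P = representations M P // rescaling_rel M P"

definition push_representation ::
    "'e matroid \<Rightarrow> ('a \<Rightarrow> 'b) \<Rightarrow> ('e set \<Rightarrow> 'e \<Rightarrow> 'a) \<Rightarrow> ('e set \<Rightarrow> 'e \<Rightarrow> 'b)" where
  "push_representation M g \<phi> = (\<lambda>H\<in>hyperplanes M. \<lambda>e\<in>ground M. g (\<phi> H e))"

text \<open>
  The action of the functor on a morphism \<open>g : P \<rightarrow> Q\<close>. The pushforward of a class is contained in
  one class of \<open>Q\<close> but need not fill it, hence the saturation.
\<close>

definition push_class ::
    "'e matroid \<Rightarrow> 'b pasture \<Rightarrow> ('a \<Rightarrow> 'b) \<Rightarrow> ('e set \<Rightarrow> 'e \<Rightarrow> 'a) set \<Rightarrow> ('e set \<Rightarrow> 'e \<Rightarrow> 'b) set" where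
  "push_class M Q g C = rescaling_rel M Q `` (push_representation M g ` C)"


section \<open>The foundation\<close>

text \<open>
  \<open>F\<close> represents the functor of rescaling classes of \<open>M\<close> via the natural bijections
  \<open>\<Phi>\<^sub>P : Hom(F, P) \<rightarrow> R\<^sub>M(P)\<close>.

  HOL cannot quantify over types inside a formula, so \<open>P\<close> ranges over all pastures whose carrier
  is a subset of the type \<open>'a\<close> that also holds the carrier of \<open>F\<close>. Every pasture representing the
  functor on all pastures therefore satisfies this predicate, whatever \<open>'a\<close> is. If \<open>'a\<close> is infinite,
  the converse holds as well: a countable pasture representing the functor on all pastures exists
  (it has finitely many generators), hence has an isomorphic copy with carrier in \<open>'a\<close>, to which
  every \<open>F\<close> satisfying the predicate is isomorphic by Yoneda.
\<close>

definition is_foundation ::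
    "'e matroid \<Rightarrow> 'a pasture \<Rightarrow> ('a pasture \<Rightarrow> ('a \<Rightarrow> 'a) \<Rightarrow> ('e set \<Rightarrow> 'e \<Rightarrow> 'a) set) \<Rightarrow> bool" where
  "is_foundation M F \<Phi> \<longleftrightarrow>
     pasture F \<and>
     (\<forall>P. pasture P \<longrightarrow> bij_betw (\<Phi> P) (pasture_hom F P) (rescaling_classes M P)) \<and>
     (\<forall>P Q g h. pasture P \<and> pasture Q \<and> g \<in> pasture_hom F P \<and> h \<in> pasture_hom P Q \<longrightarrow>
        \<Phi> Q (compose (carrier F) h g) = push_class M Q h (\<Phi> P g))"

definition universal_representation ::
    "'e matroid \<Rightarrow> 'a pasture \<Rightarrow> ('a pasture \<Rightarrow> ('a \<Rightarrow> 'a) \<Rightarrow> ('e set \<Rightarrow> 'e \<Rightarrow> 'a) set) \<Rightarrow>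
     ('e set \<Rightarrow> 'e \<Rightarrow> 'a) \<Rightarrow> bool" where
  "universal_representation M F \<Phi> \<phi> \<longleftrightarrow>
     \<phi> \<in> representations M F \<and>
     rescaling_rel M F `` {\<phi>} = \<Phi> F (\<lambda>x\<in>carrier F. x)"


section \<open>Universal cross-ratios\<close>

definition Theta :: "'e matroid \<Rightarrow> ('e set \<times> 'e set \<times> 'e set \<times> 'e set) set" where
  "Theta M = {(H1, H2, H3, H4). {H1, H2, H3, H4} \<subseteq> hyperplanes M \<and>
     (let L = H1 \<inter> H2 \<inter> H3 \<inter> H4 in
        L \<in> corank_flats M 2 \<and> (\<forall>Hi\<in>{H1, H2}. \<forall>Hj\<in>{H3, H4}. L = Hi \<inter> Hj))}"

definition cross_ratio ::
    "'a pasture \<Rightarrow> ('e set \<Rightarrow> 'e \<Rightarrow> 'a) \<Rightarrow> 'e set \<Rightarrow> 'e set \<Rightarrow> 'e set \<Rightarrow> 'e set \<Rightarrow> 'a" where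
  "cross_ratio F \<phi> H1 H2 H3 H4 =
     (let L = H1 \<inter> H2 \<inter> H3 \<inter> H4;
          a = (SOME x. x \<in> H3 - L);
          b = (SOME x. x \<in> H4 - L)
      in (\<phi> H1 a \<otimes>\<^bsub>F\<^esub> \<phi> H2 b) \<otimes>\<^bsub>F\<^esub> inv\<^bsub>F\<^esub> (\<phi> H1 b \<otimes>\<^bsub>F\<^esub> \<phi> H2 a))"

definition cross_ratios :: "'e matroid \<Rightarrow> 'a pasture \<Rightarrow> ('e set \<Rightarrow> 'e \<Rightarrow> 'a) \<Rightarrow> 'a set" where
  "cross_ratios M F \<phi> = {cross_ratio F \<phi> H1 H2 H3 H4 | H1 H2 H3 H4. (H1, H2, H3, H4) \<in> Theta M}"

end

theory Submission imports Defs begin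

text \<open>
  Let \<open>G\<close> be the group generated by \<open>-1\<close> and the cross-ratios. If the universal representation can be
  rescaled to have all nonzero values in \<open>G\<close>, then it is a representation over the subpasture
  \<open>G \<union> {0}\<close>, and its class over that pasture is a morphism \<open>F \<rightarrow> G \<union> {0}\<close> whose composition with
  the inclusion is the identity of \<open>F\<close> by the Yoneda argument; hence \<open>F = G \<union> {0}\<close>.

  Modulo \<open>G\<close> the values \<open>\<phi>\<^sub>H(e)\<close>, \<open>e \<notin> H\<close>, satisfy two kinds of relations: those saying that cross-ratios
  are trivial, and the hexagon relations that the three-term relations impose on triples of
  hyperplanes over a common coline. That such a labelling is a coboundary \<open>a\<^sub>H t\<^sub>e\<close> is proved by
  induction on the ground set. Delete a non-coloop \<open>e\<close> and normalize the labels of the deletion to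
  \<open>1\<close>. Then the label of \<open>(K, e)\<close> takes the same value for all hyperplanes \<open>K\<close> that avoid \<open>e\<close> and a
  given \<open>f \<noteq> e\<close>, and rescaling each \<open>f\<close> by this value trivializes everything.
\<close>

text \<open>Why the quad relations do not suffice: in the uniform matroid of rank 2 on three
  elements each of them is vacuous, yet the six labels modulo row and column scaling keep one
  invariant, the quotient of the two cyclic products in \<open>hex_trivial\<close>. Only the
  three-term relations control it. They make it the cube of -1, and -1 is not a product of
  cross-ratios there, so it has to be among the generators.

  What a deletion leaves open: the hyperplanes of the deletion of \<open>e\<close> come from those
  hyperplanes in which \<open>e\<close> is not a coloop. Normalizing them says nothing about the
  labels at \<open>e\<close> itself, nor about hyperplanes having \<open>e\<close> as a coloop. The
  labels at \<open>e\<close> are compared by walking through hyperplanes that avoid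
  \<open>e\<close>, which uses quad relations. Hyperplanes through \<open>e\<close> are then
  compared with neighbours avoiding \<open>e\<close>, which uses hexagons.\<close>

section \<open>Rank functions and hyperplanes\<close>

text \<open>Rank axioms in local form, one element at a time; \<open>rank_local\<close> is the
  instance of submodularity that makes \<open>span\<close> monotone. Facts about larger sets come
  from adding elements one by one, hence the finiteness assumptions.\<close>

locale rank_function =
  fixes r :: "'e set \<Rightarrow> nat"
  assumes rank_le_insert: "r X \<le> r (insert x X)"
    and rank_insert_le: "r (insert x X) \<le> Suc (r X)"
    and rank_local: "\<lbrakk>r (insert x X) = r X; r (insert y X) = r X\<rbrakk> \<Longrightarrow> r (insert x (insert y X)) = r X"
begin

text \<open>No ground set bounds this closure: for \<open>mrank M\<close> it also contains
  everything outside \<open>ground M\<close>. Hence the intersections with \<open>E\<close>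
  below.\<close>

definition span :: "'e set \<Rightarrow> 'e set" where
  "span X = {x. r (insert x X) = r X}"

lemma subset_span: "X \<subseteq> span X"
  by (auto simp: span_def insert_absorb)

lemma rank_insert_not_span: "x \<notin> span X \<Longrightarrow> r (insert x X) = Suc (r X)"
  using rank_le_insert[of X x] rank_insert_le[of x X] by (auto simp: span_def)

lemma rank_mono:
  assumes "finite Y" "X \<subseteq> Y"
  shows "r X \<le> r Y"
proof -
  have "finite Z \<Longrightarrow> r X \<le> r (Z \<union> X)" for Z
    by (induction Z rule: finite_induct) (auto intro: order_trans rank_le_insert)
  from this[OF assms(1)] show ?thesis using assms(2) by (simp add: Un_absorb2)
qed

text \<open>If \<open>y\<close> is already spanned, this is \<open>rank_local\<close>. Otherwise
  \<open>y\<close> raises the rank by one, and adding both elements cannot raise it further, because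
  \<open>x\<close> alone adds nothing.\<close>

lemma span_insert: "x \<in> span X \<Longrightarrow> x \<in> span (insert y X)"
proof (cases "y \<in> span X")
  case True
  assume "x \<in> span X"
  with True show ?thesis using rank_local[of x X y] by (simp add: span_def)
next
  case False
  assume "x \<in> span X"
  then have "r (insert y (insert x X)) \<le> Suc (r X)"
    using rank_insert_le[of y "insert x X"] by (simp add: span_def)
  then show ?thesis
    using rank_insert_not_span[OF False] rank_le_insert[of "insert y X" x]
    by (simp add: span_def insert_commute)
qed

lemma span_mono:
  assumes "finite Y" "X \<subseteq> Y"
  shows "span X \<subseteq> span Y"
proof -
  have "finite Z \<Longrightarrow> span X \<subseteq> span (Z \<union> X)" for Z
    by (induction Z rule: finite_induct) (auto intro: span_insert)
  from this[OF assms(1)] show ?thesis using assms(2) by (simp add: Un_absorb2)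
qed

lemma rank_Un_span:
  assumes "finite X" "finite Y" "Y \<subseteq> span X"
  shows "r (Y \<union> X) = r X"
  using assms(2,3)
proof (induction Y rule: finite_induct)
  case (insert y Y)
  then have "y \<in> span (Y \<union> X)"
    using span_mono[of "Y \<union> X" X] assms(1) by blast
  with insert show ?case by (simp add: span_def)
qed simp

lemma rank_eq_of_span:
  assumes "finite Y" "X \<subseteq> Y" "Y \<subseteq> span X"
  shows "r Y = r X"
  using rank_Un_span[of X Y] assms by (simp add: finite_subset Un_absorb2)

lemma span_of_rank_eq:
  assumes "finite Y" "X \<subseteq> Y" "r Y \<le> r X"
  shows "Y \<subseteq> span X"
proof
  fix y assume "y \<in> Y"
  then have "r (insert y X) \<le> r Y" using assms by (intro rank_mono) auto
  then show "y \<in> span X" using assms(3) rank_le_insert[of X y] by (simp add: span_def)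
qed

lemma span_exchange:
  assumes "y \<in> span (insert x X)" "y \<notin> span X"
  shows "x \<in> span (insert y X)"
  using assms rank_insert_not_span[OF assms(2)] rank_insert_le[of x X]
    rank_le_insert[of "insert y X" x]
  by (simp add: span_def insert_commute)

text \<open>
  The rank function stays fixed and only the ground set \<open>E\<close> varies, so that the deletion of \<open>e\<close>
  is the passage from \<open>E\<close> to \<open>E - {e}\<close>.
\<close>

definition hyp :: "'e set \<Rightarrow> 'e set \<Rightarrow> bool" where
  "hyp E H \<longleftrightarrow> H \<subseteq> E \<and> Suc (r H) = r E \<and> span H \<inter> E \<subseteq> H"

lemma hyp_subset: "hyp E H \<Longrightarrow> H \<subseteq> E" by (simp add: hyp_def)

lemma hyp_rank: "hyp E H \<Longrightarrow> Suc (r H) = r E" by (simp add: hyp_def)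

lemma hyp_span: "hyp E H \<Longrightarrow> x \<in> span H \<Longrightarrow> x \<in> E \<Longrightarrow> x \<in> H" by (auto simp: hyp_def)

text \<open>Both hyperplanes are the closure of \<open>X\<close> in \<open>E\<close>. Taken with
  \<open>X\<close> equal to one of them, it says that hyperplanes are never properly nested.\<close>

lemma hyp_eqI:
  assumes "finite E" "hyp E H" "hyp E K" "X \<subseteq> H" "X \<subseteq> K" "r E \<le> Suc (r X)"
  shows "H = K"
proof -
  have *: "H \<subseteq> K" if "hyp E H" "hyp E K" "X \<subseteq> H" "X \<subseteq> K" for H K
  proof
    fix h assume h: "h \<in> H"
    have "finite H" "finite K" using that assms(1) by (auto simp: hyp_def intro: finite_subset)
    then have "H \<subseteq> span X" "span X \<subseteq> span K"
      using span_of_rank_eq[of H X] span_mono[of K X] that assms(6) hyp_rank[of E H] by simp_all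
    then show "h \<in> K" using h that hyp_span hyp_subset by blast
  qed
  show ?thesis using *[of H K] *[of K H] assms by blast
qed

text \<open>For \<open>L\<close> of corank 2 and \<open>x\<close> outside its span, this is the
  unique hyperplane through \<open>L\<close> and \<open>x\<close>.\<close>

definition join :: "'e set \<Rightarrow> 'e set \<Rightarrow> 'e \<Rightarrow> 'e set" where
  "join E L x = span (insert x L) \<inter> E"

lemma join_hyp:
  assumes "finite E" "L \<subseteq> E" "r L + 2 = r E" "x \<in> E" "x \<notin> span L"
  shows "hyp E (join E L x)" "L \<subseteq> join E L x" "x \<in> join E L x"
proof -
  let ?X = "insert x L"
  show L: "L \<subseteq> join E L x" and x: "x \<in> join E L x"
    using subset_span[of ?X] assms by (auto simp: join_def)
  have fin: "finite (join E L x)" using assms(1) by (simp add: join_def)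
  have eq: "r (join E L x) = r ?X"
    by (rule rank_eq_of_span) (use L x fin in \<open>auto simp: join_def\<close>)
  have "span (join E L x) \<inter> E \<subseteq> join E L x"
  proof
    fix y assume y: "y \<in> span (join E L x) \<inter> E"
    then have "r (insert y (join E L x)) = r ?X" using eq by (simp add: span_def)
    moreover have "r (insert y ?X) \<le> r (insert y (join E L x))"
      by (rule rank_mono) (use fin L x in auto)
    ultimately have "y \<in> span ?X" using rank_le_insert[of ?X y] by (simp add: span_def)
    then show "y \<in> join E L x" using y by (simp add: join_def)
  qed
  then show "hyp E (join E L x)"
    using eq rank_insert_not_span[OF assms(5)] assms by (auto simp: hyp_def join_def)
qed

lemma join_eq:
  assumes "finite E" "hyp E H" "L \<subseteq> H" "r L + 2 = r E" "x \<in> H" "x \<notin> span L"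
  shows "join E L x = H"
proof (rule hyp_eqI[where X = "insert x L"])
  have "L \<subseteq> E" "x \<in> E" using assms hyp_subset by blast+
  from join_hyp[OF assms(1) this(1) assms(4) this(2) assms(6)]
  show "hyp E (join E L x)" "insert x L \<subseteq> join E L x" by auto
qed (use assms rank_insert_not_span[OF assms(6)] in auto)

lemma hyp_span_subset:
  assumes "finite E" "hyp E H" "L \<subseteq> H"
  shows "span L \<inter> E \<subseteq> H"
  using span_mono[OF finite_subset[OF hyp_subset[OF assms(2)] assms(1)] assms(3)] assms(2)
  by (auto simp: hyp_def)

text \<open>\<open>L\<close> is maximal among the sets between \<open>X\<close> and \<open>H\<close>
  whose span misses \<open>y\<close>. By maximality and exchange, \<open>L\<close> and
  \<open>y\<close> together span \<open>H\<close>, so the rank of \<open>L\<close> is one less than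
  that of \<open>H\<close>.\<close>

lemma coline_avoiding:
  assumes "finite E" "hyp E H" "X \<subseteq> H" "y \<in> H" "y \<notin> span X"
  obtains L where "X \<subseteq> L" "L \<subseteq> H" "r L + 2 = r E" "y \<notin> span L"
proof -
  define S where "S = {L. X \<subseteq> L \<and> L \<subseteq> H \<and> y \<notin> span L}"
  have finH: "finite H" using assms(1) hyp_subset[OF assms(2)] finite_subset by blast
  have "finite S" unfolding S_def by (rule finite_subset[of _ "Pow H"]) (use finH in auto)
  moreover have "X \<in> S" using assms by (simp add: S_def)
  ultimately obtain L where L: "L \<in> S" "X \<subseteq> L" and max: "\<And>L'. L' \<in> S \<Longrightarrow> L \<subseteq> L' \<Longrightarrow> L' = L"
    using finite_has_maximal2[of S X] by metis
  have "H \<subseteq> span (insert y L)"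
  proof
    fix z assume z: "z \<in> H"
    show "z \<in> span (insert y L)"
    proof (cases "z \<in> L")
      case True
      then show ?thesis using subset_span by blast
    next
      case False
      then have "insert z L \<notin> S" using max[of "insert z L"] by blast
      then have "y \<in> span (insert z L)" using L z by (auto simp: S_def)
      then show ?thesis using span_exchange L by (auto simp: S_def)
    qed
  qed
  then have "r H = r (insert y L)"
    by (intro rank_eq_of_span) (use finH L assms(4) in \<open>auto simp: S_def\<close>)
  also have "\<dots> = Suc (r L)" using L by (intro rank_insert_not_span) (simp add: S_def)
  finally have "r L + 2 = r E" using hyp_rank[OF assms(2)] by simp
  with L show thesis using that by (auto simp: S_def)
qed

end

section \<open>Labellings with trivial cross-ratios\<close>

text \<open>In the application \<open>A\<close> is the unit group of the foundation modulo the
  subgroup generated by -1 and the cross-ratios.\<close>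

locale coherent_labelling = rank_function r + comm_group A
  for r :: "'e set \<Rightarrow> nat" and A :: "('a, 'b) monoid_scheme" (structure)
begin

text \<open>
  Here and below \<open>L\<close> is any set of corank \<open>2\<close>, not necessarily a flat; this way the conditions
  pass to deletions without taking closures of \<open>L\<close>.
\<close>

definition quad_trivial :: "'e set \<Rightarrow> ('e set \<Rightarrow> 'e \<Rightarrow> 'a) \<Rightarrow> bool" where
  "quad_trivial E \<psi> \<longleftrightarrow> (\<forall>H K L e f. hyp E H \<longrightarrow> hyp E K \<longrightarrow> L \<subseteq> H \<inter> K \<longrightarrow> r L + 2 = r E \<longrightarrow>
     {e, f} \<subseteq> E - (H \<union> K) \<longrightarrow> \<psi> H e \<otimes> \<psi> K f = \<psi> H f \<otimes> \<psi> K e)"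

definition hex_trivial :: "'e set \<Rightarrow> ('e set \<Rightarrow> 'e \<Rightarrow> 'a) \<Rightarrow> bool" where
  "hex_trivial E \<psi> \<longleftrightarrow> (\<forall>H1 H2 H3 L e1 e2 e3. hyp E H1 \<longrightarrow> hyp E H2 \<longrightarrow> hyp E H3 \<longrightarrow>
     L \<subseteq> H1 \<inter> H2 \<inter> H3 \<longrightarrow> r L + 2 = r E \<longrightarrow>
     e1 \<in> H1 - (H2 \<union> H3) \<longrightarrow> e2 \<in> H2 - (H1 \<union> H3) \<longrightarrow> e3 \<in> H3 - (H1 \<union> H2) \<longrightarrow>
     \<psi> H1 e2 \<otimes> \<psi> H2 e3 \<otimes> \<psi> H3 e1 = \<psi> H1 e3 \<otimes> \<psi> H2 e1 \<otimes> \<psi> H3 e2)"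

lemma quad_trivialD:
  assumes "quad_trivial E \<psi>" "hyp E H" "hyp E K" "L \<subseteq> H" "L \<subseteq> K" "r L + 2 = r E"
    "e \<in> E" "e \<notin> H" "e \<notin> K" "f \<in> E" "f \<notin> H" "f \<notin> K"
  shows "\<psi> H e \<otimes> \<psi> K f = \<psi> H f \<otimes> \<psi> K e"
proof -
  have "L \<subseteq> H \<inter> K" "{e, f} \<subseteq> E - (H \<union> K)" using assms by auto
  then show ?thesis using assms(1-3,6) unfolding quad_trivial_def by blast
qed

lemma hex_trivialD:
  assumes "hex_trivial E \<psi>" "hyp E H1" "hyp E H2" "hyp E H3" "L \<subseteq> H1 \<inter> H2 \<inter> H3" "r L + 2 = r E"
    "e1 \<in> H1 - (H2 \<union> H3)" "e2 \<in> H2 - (H1 \<union> H3)" "e3 \<in> H3 - (H1 \<union> H2)"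
  shows "\<psi> H1 e2 \<otimes> \<psi> H2 e3 \<otimes> \<psi> H3 e1 = \<psi> H1 e3 \<otimes> \<psi> H2 e1 \<otimes> \<psi> H3 e2"
  using assms unfolding hex_trivial_def by blast

text \<open>
  By induction on the corank of \<open>K \<inter> K'\<close>: the hyperplane \<open>J\<close> is adjacent to \<open>K\<close>, avoids \<open>e\<close> and meets
  \<open>K'\<close> in more than \<open>K \<inter> K'\<close>. It may happen that every such \<open>J\<close> contains \<open>f\<close> (as in \<open>M(K\<^sub>4)\<close> for opposite
  edges \<open>e\<close>, \<open>f\<close>); the two steps \<open>K, J\<close> and \<open>J, K'\<close> then use other elements \<open>y\<close> and \<open>k\<close> in place of \<open>f\<close>.
\<close>

lemma label_eq_of_common_avoided:
  assumes fin: "finite E" and e: "e \<in> E"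
    and closed: "\<And>H f. \<psi> H f \<in> carrier A"
    and quad: "quad_trivial E \<psi>"
    and norm: "\<And>H f. \<lbrakk>hyp E H; e \<notin> H; f \<in> E; f \<notin> H; f \<noteq> e\<rbrakk> \<Longrightarrow> \<psi> H f = \<one>"
  shows "\<lbrakk>hyp E K; hyp E K'; e \<notin> K; e \<notin> K'; f \<in> E; f \<notin> K; f \<notin> K'; f \<noteq> e\<rbrakk> \<Longrightarrow> \<psi> K e = \<psi> K' e"
proof (induction "r E - r (K \<inter> K')" arbitrary: K f rule: less_induct)
  case less
  have base: "\<psi> J e = \<psi> J' e"
    if "hyp E J" "hyp E J'" "L \<subseteq> J" "L \<subseteq> J'" "r L + 2 = r E" "e \<notin> J" "e \<notin> J'"
      "f \<in> E" "f \<notin> J" "f \<notin> J'" "f \<noteq> e" for J J' L f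
    using quad_trivialD[OF quad that(1-5) e that(6-10)] norm[OF that(1,6,8,9,11)]
      norm[OF that(2,7,8,10,11)] closed by simp
  let ?L0 = "K \<inter> K'"
  have finK: "finite K" "finite K'" using less.prems fin hyp_subset finite_subset by blast+
  \<comment> \<open>Distinct hyperplanes never meet in corank 1, so corank 2 is the base of the
    induction.\<close>
  consider "K = K'" | "r ?L0 + 2 = r E" | "K \<noteq> K'" "r ?L0 + 2 < r E"
    using hyp_eqI[OF fin less.prems(1,2), of ?L0] by fastforce
  then show ?case
  proof cases
    case 1
    then show ?thesis by simp
  next
    case 2
    then show ?thesis using less.prems base[of K K' ?L0 f] by simp
  next
    case 3
    have "\<not> K \<subseteq> span ?L0"
      using rank_eq_of_span[of K ?L0] finK hyp_rank[OF less.prems(1)] 3 by auto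
    then obtain k where k: "k \<in> K" "k \<notin> span ?L0" by blast
    then obtain L where L: "?L0 \<subseteq> L" "L \<subseteq> K" "r L + 2 = r E" "k \<notin> span L"
      using coline_avoiding[OF fin less.prems(1), of ?L0 k] by blast
    have LE: "L \<subseteq> E" using L(2) less.prems(1) hyp_subset by blast
    have eL: "e \<notin> span L" using hyp_span_subset[OF fin less.prems(1) L(2)] e less.prems(3) by blast
    \<comment> \<open>An \<open>x\<close> outside the hyperplane through \<open>L\<close> and
      \<open>e\<close> gives, by exchange, a hyperplane \<open>J\<close> through \<open>L\<close>
      and \<open>x\<close> that avoids \<open>e\<close>. Taking \<open>x\<close> in
      \<open>K'\<close> makes the rank of \<open>J \<inter> K'\<close> exceed that of
      \<open>K \<inter> K'\<close>.\<close>
    have "\<not> K' \<subseteq> join E L e"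
    proof
      assume "K' \<subseteq> join E L e"
      then have "join E L e = K'"
        using hyp_eqI[OF fin join_hyp(1)[OF fin LE L(3) e eL] less.prems(2), of K']
          hyp_rank[OF less.prems(2)] by simp
      then show False using join_hyp(3)[OF fin LE L(3) e eL] less.prems(4) by simp
    qed
    then obtain x where x: "x \<in> K'" "x \<notin> join E L e" by blast
    have xE: "x \<in> E" using x less.prems(2) hyp_subset by blast
    have xL: "x \<notin> span L" using x xE span_insert[of x L e] by (auto simp: join_def)
    define J where "J = join E L x"
    have J: "hyp E J" "L \<subseteq> J" "x \<in> J"
      using join_hyp[OF fin LE L(3) xE xL] by (simp_all add: J_def)
    have eJ: "e \<notin> J" using span_exchange[of e x L] eL x xE by (auto simp: J_def join_def)
    have xK: "x \<notin> K" using x L subset_span[of L] xL by blast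
    have dec: "r E - r (J \<inter> K') < r E - r (K \<inter> K')"
    proof -
      have "x \<notin> span ?L0" using xL span_mono[OF _ L(1)] L(2) finK finite_subset by blast
      then have "Suc (r ?L0) = r (insert x ?L0)" using rank_insert_not_span by simp
      also have "\<dots> \<le> r (J \<inter> K')"
        using J L x finK by (intro rank_mono) auto
      finally show ?thesis using 3 by simp
    qed
    show ?thesis
    proof (cases "f \<in> J")
      case False
      have "\<psi> K e = \<psi> J e" using base[of K J L f] less.prems J L eJ False by simp
      also have "\<dots> = \<psi> K' e"
        using less.hyps[OF dec J(1)] less.prems eJ False by simp
      finally show ?thesis .
    next
      case True
      have "\<not> K' \<subseteq> J"
        using hyp_eqI[OF fin J(1) less.prems(2), of K'] hyp_rank[OF less.prems(2)] True less.prems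
        by auto
      \<comment> \<open>\<open>y\<close> lies outside \<open>K\<close> because
        \<open>K \<inter> K'\<close> is contained in \<open>L\<close>, hence in \<open>J\<close>. In
        turn \<open>k\<close> lies outside \<open>J\<close>: since \<open>K\<close> is the
        hyperplane through \<open>L\<close> and \<open>k\<close>, otherwise \<open>J\<close> would
        be \<open>K\<close>.\<close>
      then obtain y where y: "y \<in> K'" "y \<notin> J" by blast
      have "y \<notin> K" using y L J by blast
      moreover have "y \<in> E" "y \<noteq> e" using y less.prems hyp_subset by blast+
      ultimately have "\<psi> K e = \<psi> J e" using base[of K J L y] less.prems J L eJ y by simp
      also have "\<dots> = \<psi> K' e"
      proof (rule less.hyps[OF dec J(1) less.prems(2) eJ less.prems(4)])
        show "k \<in> E" "k \<noteq> e" using k less.prems hyp_subset by blast+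
        show "k \<notin> K'" using k subset_span by blast
        show "k \<notin> J"
        proof
          assume "k \<in> J"
          then have "J = K" using join_eq[OF fin J(1,2) L(3) _ L(4)]
            join_eq[OF fin less.prems(1) L(2,3) k(1) L(4)] by simp
          then show False using J xK by simp
        qed
      qed
      finally show ?thesis .
    qed
  qed
qed

text \<open>The conclusion says that \<open>\<psi>\<close> is a coboundary without naming the factor
  of \<open>H\<close>: after scaling by \<open>u\<close> the labels of \<open>H\<close> no longer
  depend on the element. The condition \<open>r (H - {e}) = r H\<close> in \<open>norm\<close>
  singles out the hyperplanes coming from the deletion: \<open>e\<close> is outside
  \<open>H\<close>, or inside but no coloop of \<open>H\<close>.\<close>

lemma rescaling_step:
  assumes fin: "finite E" and e: "e \<in> E" and noncoloop: "r (E - {e}) = r E"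
    and closed: "\<And>H f. \<psi> H f \<in> carrier A"
    and quad: "quad_trivial E \<psi>" and hex: "hex_trivial E \<psi>"
    and norm: "\<And>H f. \<lbrakk>hyp E H; r (H - {e}) = r H; f \<in> E; f \<notin> H; f \<noteq> e\<rbrakk> \<Longrightarrow> \<psi> H f = \<one>"
  shows "\<exists>u. (\<forall>f. u f \<in> carrier A) \<and>
    (\<forall>H f g. hyp E H \<longrightarrow> f \<in> E - H \<longrightarrow> g \<in> E - H \<longrightarrow> \<psi> H f \<otimes> u f = \<psi> H g \<otimes> u g)"
proof -
  have norm': "\<psi> H f = \<one>" if "hyp E H" "e \<notin> H" "f \<in> E" "f \<notin> H" "f \<noteq> e" for H f
    using norm[of H f] that by simp
  \<comment> \<open>Complements of hyperplanes are cocircuits, so \<open>P f K\<close> says that the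
    cocircuit \<open>E - K\<close> contains \<open>e\<close> and \<open>f\<close>. For
    \<open>f \<noteq> e\<close> such a \<open>K\<close> exists exactly when \<open>e\<close> and
    \<open>f\<close> share a connected component.\<close>
  define P where "P f K \<longleftrightarrow> hyp E K \<and> e \<notin> K \<and> f \<notin> K" for f K
  \<comment> \<open>A hyperplane \<open>K\<close> avoiding \<open>e\<close> and \<open>f\<close> has
    \<open>\<psi> K f = \<one>\<close>, so with \<open>u e = \<one>\<close> the value
    \<open>u f = \<psi> K e\<close> is forced. The default \<open>\<one>\<close> also serves the
    elements that no hyperplane avoids together with \<open>e\<close>.\<close>
  define u where
    "u f = (if f \<noteq> e \<and> (\<exists>K. P f K) then \<psi> (SOME K. P f K) e else \<one>)" for f
  have u: "u f = \<psi> K e" if "P f K" "f \<in> E" "f \<noteq> e" for f K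
  proof -
    define J where "J = (SOME K. P f K)"
    have "P f J" unfolding J_def using that(1) by (rule someI)
    then have "\<psi> J e = \<psi> K e"
      using that(1) unfolding P_def by (intro label_eq_of_common_avoided[OF fin e closed quad norm' _ _ _ _ that(2) _ _ that(3)]) auto
    then show ?thesis using that by (auto simp: u_def J_def)
  qed
  have u_closed: "u f \<in> carrier A" for f using closed by (simp add: u_def)
  have off: "\<psi> H f \<otimes> u f = \<psi> H e" if "hyp E H" "e \<notin> H" "f \<in> E" "f \<notin> H" for H f
  proof (cases "f = e")
    case True
    then show ?thesis using closed by (simp add: u_def)
  next
    case False
    then show ?thesis using norm'[OF that False] u[of f H] that closed by (simp add: P_def)
  qed
  \<comment> \<open>the hexagon relation of \<open>H\<close> and its two neighbours \<open>L \<union> {f}\<close>, \<open>L \<union> {g}\<close>, which both avoid \<open>e\<close>\<close>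
  have transfer: "\<psi> H f \<otimes> u f = \<psi> H g \<otimes> u g"
    if H: "hyp E H" "e \<in> H" and L: "L \<subseteq> H" "r L + 2 = r E" "e \<notin> span L"
      and f: "f \<in> E" "f \<notin> H" and g: "g \<in> E" "g \<notin> H" and fg: "join E L f \<noteq> join E L g" for H L f g
  proof -
    have LE: "L \<subseteq> E" using L H hyp_subset by blast
    have fgL: "f \<notin> span L" "g \<notin> span L" using hyp_span_subset[OF fin H(1) L(1)] f g by blast+
    note F = join_hyp[OF fin LE L(2) f(1) fgL(1)] and G = join_hyp[OF fin LE L(2) g(1) fgL(2)]
    have "e \<notin> join E L f"
      using join_eq[OF fin H(1) L(1,2) H(2) L(3)] join_eq[OF fin F(1,2) L(2) _ L(3)] F(3) f(2) by auto
    moreover have "e \<notin> join E L g"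
      using join_eq[OF fin H(1) L(1,2) H(2) L(3)] join_eq[OF fin G(1,2) L(2) _ L(3)] G(3) g(2) by auto
    moreover have "g \<notin> join E L f" using join_eq[OF fin F(1,2) L(2) _ fgL(2)] fg by auto
    moreover have "f \<notin> join E L g" using join_eq[OF fin G(1,2) L(2) _ fgL(1)] fg by auto
    moreover have "e \<noteq> f" "e \<noteq> g" using H f g by auto
    \<comment> \<open>The hyperplane through \<open>g\<close> avoids \<open>e\<close> and
      \<open>f\<close>, so its label at \<open>f\<close> is \<open>\<one>\<close> and its label at
      \<open>e\<close> is \<open>u f\<close>. The one through \<open>f\<close> gives
      \<open>u g\<close> in the same way, and the hexagon collapses to the claim.\<close>
    moreover have "\<psi> H f \<otimes> \<psi> (join E L f) g \<otimes> \<psi> (join E L g) e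
        = \<psi> H g \<otimes> \<psi> (join E L f) e \<otimes> \<psi> (join E L g) f"
      by (rule hex_trivialD[OF hex H(1) F(1) G(1), of L])
        (use calculation H L F G f g in auto)
    ultimately show ?thesis
      using norm'[OF F(1)] norm'[OF G(1)] u[of f "join E L g"] u[of g "join E L f"] F(1) G(1) f g closed
      by (simp add: P_def)
  qed
  \<comment> \<open>\<open>transfer\<close> requires \<open>f\<close> and \<open>g\<close> to lie in
    different hyperplanes over \<open>L\<close>. If they lie in the same one, an \<open>x\<close>
    from \<open>K\<close> outside it serves as an intermediate; \<open>x\<close> is outside
    \<open>H\<close> because \<open>H \<inter> K\<close> is contained in \<open>L\<close>.\<close>
  have seen: "\<psi> H f \<otimes> u f = \<psi> H g \<otimes> u g"
    if H: "hyp E H" "e \<in> H" and K: "P f K"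
      and f: "f \<in> E" "f \<notin> H" and g: "g \<in> E" "g \<notin> H" for H K f g
  proof -
    have K': "hyp E K" "e \<notin> K" "f \<notin> K" using K by (auto simp: P_def)
    have "e \<notin> span (H \<inter> K)" using hyp_span_subset[OF fin K'(1), of "H \<inter> K"] e K'(2) by blast
    then obtain L where L: "H \<inter> K \<subseteq> L" "L \<subseteq> H" "r L + 2 = r E" "e \<notin> span L"
      using coline_avoiding[OF fin H(1), of "H \<inter> K" e] H(2) by blast
    have LE: "L \<subseteq> E" using L H hyp_subset by blast
    have fL: "f \<notin> span L" using hyp_span_subset[OF fin H(1) L(2)] f by blast
    note F = join_hyp[OF fin LE L(3) f(1) fL]
    have "\<not> K \<subseteq> join E L f"
      using hyp_eqI[OF fin F(1) K'(1), of K] hyp_rank[OF K'(1)] F(3) K'(3) by auto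
    then obtain x where x: "x \<in> K" "x \<notin> join E L f" by blast
    have xE: "x \<in> E" using x K' hyp_subset by blast
    have xH: "x \<notin> H" using x L F by blast
    have "x \<notin> span L" using hyp_span_subset[OF fin H(1) L(2)] xE xH by blast
    note X = join_hyp[OF fin LE L(3) xE this]
    have fx: "join E L f \<noteq> join E L x" using X x by blast
    show ?thesis
    proof (cases "join E L f = join E L g")
      case False
      then show ?thesis using transfer[OF H L(2-4) f g] by simp
    next
      case True
      then have "\<psi> H g \<otimes> u g = \<psi> H x \<otimes> u x" using transfer[OF H L(2-4) g xE xH] fx by simp
      then show ?thesis using transfer[OF H L(2-4) f xE xH fx] by simp
    qed
  qed
  \<comment> \<open>no hyperplane avoids \<open>e\<close> and \<open>f\<close>: then \<open>e\<close> is no coloop of \<open>H\<close>, so \<open>H\<close> was already normalized\<close>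
  have unseen: "\<psi> H f \<otimes> u f = \<one>"
    if H: "hyp E H" "e \<in> H" and K: "\<nexists>K. P f K" and f: "f \<in> E" "f \<notin> H" for H f
  proof -
    have "r (H - {e}) = r H"
    proof (rule ccontr)
      let ?L = "H - {e}"
      assume neq: "r (H - {e}) \<noteq> r H"
      have H': "insert e ?L = H" using H by blast
      then have eL: "e \<notin> span ?L" using neq unfolding span_def by auto
      have L: "?L \<subseteq> H" "?L \<subseteq> E" "r ?L + 2 = r E"
        using H H' hyp_subset hyp_rank[OF H(1)] rank_insert_not_span[OF eL] by auto
      have fL: "f \<notin> span ?L" using hyp_span_subset[OF fin H(1) L(1)] f by blast
      note F = join_hyp[OF fin L(2,3) f(1) fL]
      \<comment> \<open>Since \<open>e\<close> is no coloop, no hyperplane contains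
        \<open>E - {e}\<close>. So some \<open>x \<noteq> e\<close> lies outside the hyperplane
        through \<open>?L\<close> and \<open>f\<close>; the hyperplane through \<open>?L\<close> and
        \<open>x\<close> then avoids \<open>f\<close> and, being different from \<open>H\<close>,
        also \<open>e\<close>.\<close>
      have "\<not> E - {e} \<subseteq> join E ?L f"
      proof
        assume "E - {e} \<subseteq> join E ?L f"
        then have "r E \<le> r (join E ?L f)"
          using rank_mono[of "join E ?L f" "E - {e}"] noncoloop fin by (simp add: join_def)
        then show False using hyp_rank[OF F(1)] by simp
      qed
      then obtain x where x: "x \<in> E" "x \<noteq> e" "x \<notin> join E ?L f" by blast
      have xH: "x \<notin> H" using x F by blast
      have xL: "x \<notin> span ?L" using hyp_span_subset[OF fin H(1) L(1)] x xH by blast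
      note X = join_hyp[OF fin L(2,3) x(1) xL]
      have "e \<notin> join E ?L x"
        using join_eq[OF fin H(1) L(1,3) H(2) eL] join_eq[OF fin X(1,2) L(3) _ eL] X(3) xH by auto
      moreover have "f \<notin> join E ?L x" using join_eq[OF fin X(1,2) L(3) _ fL] X(3) x by auto
      ultimately show False using K X(1) by (auto simp: P_def)
    qed
    moreover have "f \<noteq> e" using H f by blast
    ultimately show ?thesis using norm[OF H(1) _ f] K by (simp add: u_def)
  qed
  show ?thesis
  proof (intro exI[of _ u] conjI allI impI)
    show "u f \<in> carrier A" for f by (rule u_closed)
    fix H f g assume a: "hyp E H" "f \<in> E - H" "g \<in> E - H"
    show "\<psi> H f \<otimes> u f = \<psi> H g \<otimes> u g"
    proof (cases "e \<in> H")
      case False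
      then show ?thesis using off[OF a(1)] a by simp
    next
      case True
      then show ?thesis
        using seen[where H = H and f = f and g = g] seen[where H = H and f = g and g = f] unseen[of H f] unseen[of H g] a by fastforce
    qed
  qed
qed

section \<open>Hyperplanes of the deletion of a non-coloop\<close>

lemma hyp_delete:
  assumes fin: "finite E" and "r (E - {e}) = r E" and K: "hyp (E - {e}) K"
  shows "hyp E (span K \<inter> E)" "(span K \<inter> E) - {e} = K"
proof -
  have KE: "K \<subseteq> E" "e \<notin> K" using hyp_subset[OF K] by auto
  have KS: "K \<subseteq> span K \<inter> E" using KE subset_span by blast
  have eq: "r (span K \<inter> E) = r K" by (rule rank_eq_of_span) (use fin KS in auto)
  have "x \<in> span K" if "x \<in> span (span K \<inter> E)" for x
  proof -
    have "r (insert x K) \<le> r (insert x (span K \<inter> E))" by (rule rank_mono) (use KS fin in auto)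
    also have "\<dots> = r K" using that eq by (simp add: span_def)
    finally show ?thesis using rank_le_insert[of K x] by (simp add: span_def)
  qed
  then show "hyp E (span K \<inter> E)" using eq hyp_rank[OF K] assms(2) by (auto simp: hyp_def)
  show "(span K \<inter> E) - {e} = K" using KS KE hyp_span[OF K] by blast
qed

text \<open>The inverse of the passage to closures in \<open>hyp_delete\<close>. It fails when
  \<open>e\<close> is a coloop of \<open>H\<close>, because \<open>H - {e}\<close> then drops to
  corank 2.\<close>

lemma hyp_delete_rev:
  assumes fin: "finite E" and "r (E - {e}) = r E" and H: "hyp E H" "r (H - {e}) = r H"
  shows "hyp (E - {e}) (H - {e})" "span (H - {e}) \<inter> E = H"
proof -
  have finH: "finite H" using fin H(1) hyp_subset finite_subset by blast
  have "H \<subseteq> span (H - {e})" by (rule span_of_rank_eq) (use finH H in auto)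
  moreover have sub: "span (H - {e}) \<inter> E \<subseteq> H" using hyp_span_subset[OF fin H(1), of "H - {e}"] by blast
  ultimately show "span (H - {e}) \<inter> E = H" using hyp_subset[OF H(1)] by blast
  show "hyp (E - {e}) (H - {e})"
    using sub hyp_subset[OF H(1)] hyp_rank[OF H(1)] assms(2) H(2) by (auto simp: hyp_def)
qed

theorem exists_rescaling:
  assumes "finite E" "\<And>H f. \<psi> H f \<in> carrier A" "quad_trivial E \<psi>" "hex_trivial E \<psi>"
  shows "\<exists>u. (\<forall>f. u f \<in> carrier A) \<and>
    (\<forall>H f g. hyp E H \<longrightarrow> f \<in> E - H \<longrightarrow> g \<in> E - H \<longrightarrow> \<psi> H f \<otimes> u f = \<psi> H g \<otimes> u g)"
  using assms
proof (induction "card E" arbitrary: E \<psi> rule: less_induct)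
  case less
  note fin = less.prems(1) and closed = less.prems(2)
  show ?case
  proof (cases "\<exists>e\<in>E. r (E - {e}) = r E")
    case False
    \<comment> \<open>Every element is a coloop, so the complement of a hyperplane has a single
      element and there is nothing to compare.\<close>
    have "f = g" if H: "hyp E H" "f \<in> E - H" "g \<in> E - H" for H f g
    proof (rule ccontr)
      assume "f \<noteq> g"
      then have "r (insert g H) \<le> r (E - {f})"
        using H hyp_subset[OF H(1)] fin by (intro rank_mono) auto
      moreover have "r (E - {f}) \<le> r E" using fin by (intro rank_mono) auto
      ultimately have "r (insert g H) \<le> r H" using False H hyp_rank[OF H(1)] by fastforce
      then have "g \<in> span H" using rank_le_insert[of H g] by (simp add: span_def)
      then show False using H hyp_span by blast
    qed
    then show ?thesis by (intro exI[of _ "\<lambda>_. \<one>"]) auto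
  next
    case True
    then obtain e where e: "e \<in> E" "r (E - {e}) = r E" by blast
    define cl where "cl K = span K \<inter> E" for K
    let ?N = "E - {e}" and ?\<psi> = "\<lambda>K f. \<psi> (cl K) f"
    note D = hyp_delete[OF fin e(2), folded cl_def]
    have mem: "x \<in> cl K \<longleftrightarrow> x \<in> K" if "hyp ?N K" "x \<in> ?N" for K x using D(2)[OF that(1)] that by blast
    have sub: "L \<subseteq> cl K" if "hyp ?N K" "L \<subseteq> K" for K L using D(2)[OF that(1)] that by blast
    have quadN: "quad_trivial ?N ?\<psi>"
      unfolding quad_trivial_def
    proof (intro allI impI)
      fix H K L a b
      assume a: "hyp ?N H" "hyp ?N K" "L \<subseteq> H \<inter> K" "r L + 2 = r ?N" "{a, b} \<subseteq> ?N - (H \<union> K)"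
      show "?\<psi> H a \<otimes> ?\<psi> K b = ?\<psi> H b \<otimes> ?\<psi> K a"
        by (rule quad_trivialD[OF less.prems(3) D(1)[OF a(1)] D(1)[OF a(2)], of L])
          (use a e in \<open>simp_all add: mem sub\<close>)
    qed
    have hexN: "hex_trivial ?N ?\<psi>"
      unfolding hex_trivial_def
    proof (intro allI impI)
      fix H1 H2 H3 L e1 e2 e3
      assume a: "hyp ?N H1" "hyp ?N H2" "hyp ?N H3" "L \<subseteq> H1 \<inter> H2 \<inter> H3" "r L + 2 = r ?N"
        "e1 \<in> H1 - (H2 \<union> H3)" "e2 \<in> H2 - (H1 \<union> H3)" "e3 \<in> H3 - (H1 \<union> H2)"
      have N: "e1 \<in> ?N" "e2 \<in> ?N" "e3 \<in> ?N" using a hyp_subset by blast+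
      show "?\<psi> H1 e2 \<otimes> ?\<psi> H2 e3 \<otimes> ?\<psi> H3 e1 = ?\<psi> H1 e3 \<otimes> ?\<psi> H2 e1 \<otimes> ?\<psi> H3 e2"
      proof (rule hex_trivialD[OF less.prems(4) D(1)[OF a(1)] D(1)[OF a(2)] D(1)[OF a(3)]])
        show "L \<subseteq> cl H1 \<inter> cl H2 \<inter> cl H3" using a by (simp add: sub)
        show "r L + 2 = r E" using a e by simp
      qed (use a(6-8) mem[OF a(1) N(1)] mem[OF a(1) N(2)] mem[OF a(1) N(3)] mem[OF a(2) N(1)]
          mem[OF a(2) N(2)] mem[OF a(2) N(3)] mem[OF a(3) N(1)] mem[OF a(3) N(2)] mem[OF a(3) N(3)]
          in \<open>simp_all only: Diff_iff Un_iff simp_thms\<close>)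
    qed
    have "card ?N < card E" using card_Diff1_less[OF fin e(1)] .
    then have "\<exists>u. (\<forall>f. u f \<in> carrier A) \<and>
        (\<forall>K f g. hyp ?N K \<longrightarrow> f \<in> ?N - K \<longrightarrow> g \<in> ?N - K \<longrightarrow> ?\<psi> K f \<otimes> u f = ?\<psi> K g \<otimes> u g)"
      by (rule less.hyps[OF _ _ closed quadN hexN]) (use fin in simp)
    then obtain u where u: "\<And>f. u f \<in> carrier A"
      "\<And>K f g. hyp ?N K \<Longrightarrow> f \<in> ?N - K \<Longrightarrow> g \<in> ?N - K \<Longrightarrow> ?\<psi> K f \<otimes> u f = ?\<psi> K g \<otimes> u g"
      by blast
    \<comment> \<open>For a hyperplane coming from the deletion, the inverted value does not depend
      on the chosen element, so \<open>d H\<close> trivializes all its labels away from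
      \<open>e\<close>. For the other hyperplanes \<open>d H\<close> may be any group
      element.\<close>
    define d where "d H = (let f = SOME f. f \<in> ?N - H in inv (\<psi> H f \<otimes> u f))" for H
    define \<psi>' where "\<psi>' H f = \<psi> H f \<otimes> (u f \<otimes> d H)" for H f
    have d_closed: "d H \<in> carrier A" for H using closed u(1) by (simp add: d_def Let_def)
    have closed': "\<psi>' H f \<in> carrier A" for H f using closed u(1) d_closed by (simp add: \<psi>'_def)
    \<comment> \<open>Scaling by hyperplanes and by elements multiplies both sides of a quad or
      hexagon relation by the same factors.\<close>
    have quad': "quad_trivial E \<psi>'"
      unfolding quad_trivial_def
    proof (intro allI impI)
      fix H K L a b
      assume a: "hyp E H" "hyp E K" "L \<subseteq> H \<inter> K" "r L + 2 = r E" "{a, b} \<subseteq> E - (H \<union> K)"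
      have "\<psi>' H a \<otimes> \<psi>' K b = (\<psi> H a \<otimes> \<psi> K b) \<otimes> (u a \<otimes> u b \<otimes> d H \<otimes> d K)"
        using closed u(1) d_closed by (simp add: \<psi>'_def m_ac)
      also have "\<psi> H a \<otimes> \<psi> K b = \<psi> H b \<otimes> \<psi> K a"
        using quad_trivialD[OF less.prems(3) a(1,2), of L a b] a by simp
      also have "\<dots> \<otimes> (u a \<otimes> u b \<otimes> d H \<otimes> d K) = \<psi>' H b \<otimes> \<psi>' K a"
        using closed u(1) d_closed by (simp add: \<psi>'_def m_ac)
      finally show "\<psi>' H a \<otimes> \<psi>' K b = \<psi>' H b \<otimes> \<psi>' K a" .
    qed
    have hex': "hex_trivial E \<psi>'"
      unfolding hex_trivial_def
    proof (intro allI impI)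
      fix H1 H2 H3 L e1 e2 e3
      assume a: "hyp E H1" "hyp E H2" "hyp E H3" "L \<subseteq> H1 \<inter> H2 \<inter> H3" "r L + 2 = r E"
        "e1 \<in> H1 - (H2 \<union> H3)" "e2 \<in> H2 - (H1 \<union> H3)" "e3 \<in> H3 - (H1 \<union> H2)"
      let ?c = "u e1 \<otimes> u e2 \<otimes> u e3 \<otimes> d H1 \<otimes> d H2 \<otimes> d H3"
      have "\<psi>' H1 e2 \<otimes> \<psi>' H2 e3 \<otimes> \<psi>' H3 e1 = (\<psi> H1 e2 \<otimes> \<psi> H2 e3 \<otimes> \<psi> H3 e1) \<otimes> ?c"
        using closed u(1) d_closed by (simp add: \<psi>'_def m_ac)
      also have "\<psi> H1 e2 \<otimes> \<psi> H2 e3 \<otimes> \<psi> H3 e1 = \<psi> H1 e3 \<otimes> \<psi> H2 e1 \<otimes> \<psi> H3 e2"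
        by (rule hex_trivialD[OF less.prems(4) a])
      also have "\<dots> \<otimes> ?c = \<psi>' H1 e3 \<otimes> \<psi>' H2 e1 \<otimes> \<psi>' H3 e2"
        using closed u(1) d_closed by (simp add: \<psi>'_def m_ac)
      finally show "\<psi>' H1 e2 \<otimes> \<psi>' H2 e3 \<otimes> \<psi>' H3 e1 = \<psi>' H1 e3 \<otimes> \<psi>' H2 e1 \<otimes> \<psi>' H3 e2" .
    qed
    have norm: "\<psi>' H f = \<one>" if H: "hyp E H" "r (H - {e}) = r H" and f: "f \<in> E" "f \<notin> H" "f \<noteq> e" for H f
    proof -
      note R = hyp_delete_rev[OF fin e(2) H, folded cl_def]
      let ?g = "SOME f. f \<in> ?N - H"
      have fN: "f \<in> ?N - H" using f by simp
      then have "?g \<in> ?N - H" by (rule someI)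
      then have "\<psi> H f \<otimes> u f = \<psi> H ?g \<otimes> u ?g"
        using u(2)[OF R(1), of f ?g] fN R(2) by auto
      then have "\<psi>' H f = (\<psi> H ?g \<otimes> u ?g) \<otimes> d H"
        using closed u(1) d_closed by (simp add: \<psi>'_def m_assoc[symmetric])
      then show ?thesis using closed u(1) by (simp add: d_def Let_def)
    qed
    obtain v where v: "\<And>f. v f \<in> carrier A"
      "\<And>H f g. hyp E H \<Longrightarrow> f \<in> E - H \<Longrightarrow> g \<in> E - H \<Longrightarrow> \<psi>' H f \<otimes> v f = \<psi>' H g \<otimes> v g"
      using rescaling_step[OF fin e closed' quad' hex' norm] by blast
    show ?thesis
    proof (intro exI[of _ "\<lambda>f. u f \<otimes> v f"] conjI allI impI)
      show "u f \<otimes> v f \<in> carrier A" for f using u(1) v(1) by simp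
      fix H f g assume a: "hyp E H" "f \<in> E - H" "g \<in> E - H"
      have *: "\<psi>' H x \<otimes> v x = d H \<otimes> (\<psi> H x \<otimes> (u x \<otimes> v x))" for x
        using closed u(1) v(1) d_closed by (simp add: \<psi>'_def m_ac)
      have "\<psi>' H f \<otimes> v f = \<psi>' H g \<otimes> v g" by (rule v(2)[OF a])
      then show "\<psi> H f \<otimes> (u f \<otimes> v f) = \<psi> H g \<otimes> (u g \<otimes> v g)"
        unfolding * using closed u(1) v(1) d_closed by simp
    qed
  qed
qed

end

text \<open>Modulo \<open>S\<close> the relations up to \<open>S\<close> become equations in the
  commutative group \<open>U Mod S\<close>. Coset representatives of the scaling factors found there
  are the required \<open>t\<close>, and equality of cosets becomes membership of a quotient in
  \<open>S\<close>.\<close>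

theorem (in rank_function) exists_rescaling_mod_subgroup:
  fixes U (structure)
  assumes U: "comm_group U" and S: "subgroup S U" and fin: "finite E"
    and closed: "\<And>H f. hyp E H \<Longrightarrow> f \<in> E - H \<Longrightarrow> \<psi> H f \<in> carrier U"
    and quad: "\<And>H K L e f. \<lbrakk>hyp E H; hyp E K; L \<subseteq> H \<inter> K; r L + 2 = r E; {e, f} \<subseteq> E - (H \<union> K)\<rbrakk>
      \<Longrightarrow> \<exists>s\<in>S. \<psi> H e \<otimes> \<psi> K f = s \<otimes> (\<psi> H f \<otimes> \<psi> K e)"
    and hex: "\<And>H1 H2 H3 L e1 e2 e3. \<lbrakk>hyp E H1; hyp E H2; hyp E H3;
      L \<subseteq> H1 \<inter> H2 \<inter> H3; r L + 2 = r E;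
      e1 \<in> H1 - (H2 \<union> H3); e2 \<in> H2 - (H1 \<union> H3); e3 \<in> H3 - (H1 \<union> H2)\<rbrakk>
      \<Longrightarrow> \<exists>s\<in>S. \<psi> H1 e2 \<otimes> \<psi> H2 e3 \<otimes> \<psi> H3 e1 = s \<otimes> (\<psi> H1 e3 \<otimes> \<psi> H2 e1 \<otimes> \<psi> H3 e2)"
  obtains t where "\<And>f. t f \<in> carrier U"
    "\<And>H f g. \<lbrakk>hyp E H; f \<in> E - H; g \<in> E - H\<rbrakk> \<Longrightarrow> \<psi> H f \<otimes> t f \<otimes> inv (\<psi> H g \<otimes> t g) \<in> S"
proof -
  interpret U: comm_group U by fact
  interpret S: normal S U by (rule U.subgroup_imp_normal[OF S])
  interpret Q: comm_group "U Mod S" by (rule U.abelian_FactGroup[OF S])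
  interpret coherent_labelling r "U Mod S" ..
  have absorb: "S #> (s \<otimes> x) = S #> x" if "s \<in> S" "x \<in> carrier U" for s x
    using that S.subset U.coset_mult_assoc[of S s x] S.rcos_const[OF U.group_axioms, of s] by auto
  have cos_mult: "(S #> x) \<otimes>\<^bsub>U Mod S\<^esub> (S #> y) = S #> (x \<otimes> y)" if "x \<in> carrier U" "y \<in> carrier U" for x y
    using S.rcos_sum[OF that] by (simp add: FactGroup_def)
  have cos_carrier: "S #> x \<in> carrier (U Mod S)" if "x \<in> carrier U" for x
    using that by (auto simp: FactGroup_def RCOSETS_def)
  \<comment> \<open>The unit as default makes the labelling total with values in the group, as
    \<open>exists_rescaling\<close> demands.\<close>
  define \<chi> where "\<chi> H f = (if hyp E H \<and> f \<in> E - H then S #> \<psi> H f else \<one>\<^bsub>U Mod S\<^esub>)" for H f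
  have \<chi>_closed: "\<chi> H f \<in> carrier (U Mod S)" for H f
    using cos_carrier closed Q.one_closed by (simp add: \<chi>_def del: one_FactGroup)
  have "quad_trivial E \<chi>"
    unfolding quad_trivial_def
  proof (intro allI impI)
    fix H K L e f
    assume a: "hyp E H" "hyp E K" "L \<subseteq> H \<inter> K" "r L + 2 = r E" "{e, f} \<subseteq> E - (H \<union> K)"
    then have c: "\<psi> H e \<in> carrier U" "\<psi> K f \<in> carrier U" "\<psi> H f \<in> carrier U" "\<psi> K e \<in> carrier U"
      using closed by auto
    obtain s where s: "s \<in> S" "\<psi> H e \<otimes> \<psi> K f = s \<otimes> (\<psi> H f \<otimes> \<psi> K e)" using quad[OF a] by blast
    show "\<chi> H e \<otimes>\<^bsub>U Mod S\<^esub> \<chi> K f = \<chi> H f \<otimes>\<^bsub>U Mod S\<^esub> \<chi> K e"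
      using a c s absorb[OF s(1)] by (simp add: \<chi>_def cos_mult del: mult_FactGroup)
  qed
  moreover have "hex_trivial E \<chi>"
    unfolding hex_trivial_def
  proof (intro allI impI)
    fix H1 H2 H3 L e1 e2 e3
    assume a: "hyp E H1" "hyp E H2" "hyp E H3" "L \<subseteq> H1 \<inter> H2 \<inter> H3" "r L + 2 = r E"
      "e1 \<in> H1 - (H2 \<union> H3)" "e2 \<in> H2 - (H1 \<union> H3)" "e3 \<in> H3 - (H1 \<union> H2)"
    then have E: "e1 \<in> E" "e2 \<in> E" "e3 \<in> E" using hyp_subset by blast+
    then have c: "\<psi> H1 e2 \<in> carrier U" "\<psi> H1 e3 \<in> carrier U" "\<psi> H2 e1 \<in> carrier U"
      "\<psi> H2 e3 \<in> carrier U" "\<psi> H3 e1 \<in> carrier U" "\<psi> H3 e2 \<in> carrier U"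
      using a closed by auto
    obtain s where s: "s \<in> S"
      "\<psi> H1 e2 \<otimes> \<psi> H2 e3 \<otimes> \<psi> H3 e1 = s \<otimes> (\<psi> H1 e3 \<otimes> \<psi> H2 e1 \<otimes> \<psi> H3 e2)"
      using hex[OF a] by blast
    show "\<chi> H1 e2 \<otimes>\<^bsub>U Mod S\<^esub> \<chi> H2 e3 \<otimes>\<^bsub>U Mod S\<^esub> \<chi> H3 e1
        = \<chi> H1 e3 \<otimes>\<^bsub>U Mod S\<^esub> \<chi> H2 e1 \<otimes>\<^bsub>U Mod S\<^esub> \<chi> H3 e2"
      using a E c s absorb[OF s(1)] by (simp add: \<chi>_def cos_mult del: mult_FactGroup)
  qed
  ultimately have "\<exists>u. (\<forall>f. u f \<in> carrier (U Mod S)) \<and> (\<forall>H f g. hyp E H \<longrightarrow> f \<in> E - H \<longrightarrow> g \<in> E - H \<longrightarrow>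
      \<chi> H f \<otimes>\<^bsub>U Mod S\<^esub> u f = \<chi> H g \<otimes>\<^bsub>U Mod S\<^esub> u g)"
    by (rule exists_rescaling[where \<psi> = \<chi>, OF fin \<chi>_closed])
  then obtain u where u: "\<And>f. u f \<in> carrier (U Mod S)"
    "\<And>H f g. \<lbrakk>hyp E H; f \<in> E - H; g \<in> E - H\<rbrakk>
      \<Longrightarrow> \<chi> H f \<otimes>\<^bsub>U Mod S\<^esub> u f = \<chi> H g \<otimes>\<^bsub>U Mod S\<^esub> u g"
    by blast
  have "\<exists>x\<in>carrier U. u f = S #> x" for f
    using u(1)[of f] by (auto simp: FactGroup_def RCOSETS_def)
  then obtain t where t: "\<And>f. t f \<in> carrier U" "\<And>f. u f = S #> t f" by metis
  show thesis
  proof (rule that[of t])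
    show "t f \<in> carrier U" for f by (rule t(1))
    fix H f g assume a: "hyp E H" "f \<in> E - H" "g \<in> E - H"
    have c: "\<psi> H f \<otimes> t f \<in> carrier U" "\<psi> H g \<otimes> t g \<in> carrier U" using closed a t(1) by auto
    have "S #> (\<psi> H f \<otimes> t f) = S #> (\<psi> H g \<otimes> t g)"
      using u(2)[OF a] a t closed by (simp add: \<chi>_def cos_mult del: mult_FactGroup)
    then have "\<psi> H f \<otimes> t f \<in> S #> (\<psi> H g \<otimes> t g)"
      using U.rcos_self[OF c(1) S] by simp
    then show "\<psi> H f \<otimes> t f \<otimes> inv (\<psi> H g \<otimes> t g) \<in> S"
      using S.rcos_module[OF U.group_axioms c(2,1)] by simp
  qed
qed

section \<open>Matroids\<close>

lemma
  assumes "matroid M"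
  shows matroid_finite: "finite (ground M)"
    and matroid_indep_subset: "I \<in> indeps M \<Longrightarrow> I \<subseteq> ground M"
    and matroid_empty_indep: "{} \<in> indeps M"
    and matroid_subset_indep: "I \<in> indeps M \<Longrightarrow> J \<subseteq> I \<Longrightarrow> J \<in> indeps M"
    and matroid_augment: "I \<in> indeps M \<Longrightarrow> J \<in> indeps M \<Longrightarrow> card I < card J \<Longrightarrow>
      \<exists>x\<in>J - I. insert x I \<in> indeps M"
  using assms unfolding matroid_def by blast+

lemma finite_indeps: "matroid M \<Longrightarrow> finite (indeps M)"
  by (rule finite_subset[of _ "Pow (ground M)"]) (auto simp: matroid_finite dest: matroid_indep_subset)

lemma mrank_ge:
  assumes "matroid M" "I \<in> indeps M" "I \<subseteq> X"
  shows "card I \<le> mrank M X"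
  unfolding mrank_def by (rule Max_ge) (use assms finite_indeps[OF assms(1)] in auto)

lemma mrank_witness:
  assumes "matroid M"
  obtains I where "I \<in> indeps M" "I \<subseteq> X" "finite I" "card I = mrank M X"
proof -
  have "mrank M X \<in> card ` {I \<in> indeps M. I \<subseteq> X}"
    unfolding mrank_def by (rule Max_in) (use finite_indeps[OF assms] matroid_empty_indep[OF assms] in auto)
  then obtain I where I: "I \<in> indeps M" "I \<subseteq> X" "card I = mrank M X" by auto
  have "finite I"
    using matroid_indep_subset[OF assms I(1)] matroid_finite[OF assms] by (rule finite_subset)
  with I show thesis using that by blast
qed

lemma rank_function_mrank:
  assumes M: "matroid M"
  shows "rank_function (mrank M)"
proof
  fix X x
  obtain I where I: "I \<in> indeps M" "I \<subseteq> X" "card I = mrank M X" using mrank_witness[OF M, of X] .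
  have "card I \<le> mrank M (insert x X)" by (rule mrank_ge[OF M I(1)]) (use I in auto)
  then show "mrank M X \<le> mrank M (insert x X)" using I by simp
  obtain J where J: "J \<in> indeps M" "J \<subseteq> insert x X" "finite J" "card J = mrank M (insert x X)"
    using mrank_witness[OF M, of "insert x X"] .
  have sub: "J - {x} \<in> indeps M" using matroid_subset_indep[OF M J(1)] by simp
  have "card (J - {x}) \<le> mrank M X" by (rule mrank_ge[OF M sub]) (use J in auto)
  moreover have "card J \<le> Suc (card (J - {x}))" using card_Suc_Diff1[OF J(3), of x] by (cases "x \<in> J") simp_all
  ultimately show "mrank M (insert x X) \<le> Suc (mrank M X)" using J by simp
next
  fix X x y
  assume x: "mrank M (insert x X) = mrank M X" and y: "mrank M (insert y X) = mrank M X"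
  obtain I where I: "I \<in> indeps M" "I \<subseteq> X" "finite I" "card I = mrank M X"
    using mrank_witness[OF M, of X] .
  let ?Z = "insert x (insert y X)"
  obtain J where J: "J \<in> indeps M" "J \<subseteq> ?Z" "finite J" "card J = mrank M ?Z"
    using mrank_witness[OF M, of ?Z] .
  \<comment> \<open>A larger \<open>J\<close> would extend the basis \<open>I\<close> of
    \<open>X\<close> by a single element, so adding \<open>x\<close> alone or \<open>y\<close> alone
    would already raise the rank of \<open>X\<close>.\<close>
  have "\<not> card I < card J"
  proof
    assume "card I < card J"
    then obtain z where z: "z \<in> J - I" "insert z I \<in> indeps M" 
      using matroid_augment[OF M I(1) J(1)] by blast
    then have "card (insert z I) = Suc (mrank M X)" using I by simp
    moreover have "insert z I \<subseteq> insert x X \<or> insert z I \<subseteq> insert y X" using z I J by blast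
    ultimately show False
      using mrank_ge[OF M z(2), of "insert x X"] mrank_ge[OF M z(2), of "insert y X"] x y by auto
  qed
  moreover have "card I \<le> mrank M ?Z" by (rule mrank_ge[OF M I(1)]) (use I in auto)
  ultimately show "mrank M ?Z = mrank M X" using I J by simp
qed

locale matroid_struct =
  fixes M :: "'e matroid"
  assumes matroid: "matroid M"
begin

sublocale rank_function "mrank M"
  by (rule rank_function_mrank[OF matroid])

abbreviation E where "E \<equiv> ground M"

lemma finite_ground: "finite E"
  by (rule matroid_finite[OF matroid])

lemma corank_flats_iff:
  "X \<in> corank_flats M k \<longleftrightarrow> X \<subseteq> E \<and> mrank M X + k = mrank M E \<and> span X \<inter> E \<subseteq> X"
proof -
  have "mrank M X < mrank M (insert e X) \<longleftrightarrow> e \<notin> span X" for e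
    using rank_le_insert[of X e] by (auto simp: span_def)
  then show ?thesis by (auto simp: corank_flats_def flats_def)
qed

lemma hyperplanes_iff: "H \<in> hyperplanes M \<longleftrightarrow> hyp E H"
  by (auto simp: hyperplanes_def hyp_def corank_flats_iff)

lemma hyp_nonempty_compl: "hyp E H \<Longrightarrow> \<exists>e. e \<in> E - H"
  using hyp_rank[of E H] hyp_subset[of E H] by (cases "H = E") auto

lemma hyp_not_subset: "hyp E H \<Longrightarrow> hyp E K \<Longrightarrow> H \<noteq> K \<Longrightarrow> \<exists>e. e \<in> H - K"
  using hyp_eqI[OF finite_ground, of H K H] hyp_rank[of E H] by auto

text \<open>Replaces a mere set \<open>L\<close> of corank 2 by the flat that the definitions of
  representations and of \<open>Theta\<close> ask for.\<close>

lemma coline_Int: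
  assumes "hyp E H" "hyp E K" "H \<noteq> K" "L \<subseteq> H \<inter> K" "mrank M L + 2 = mrank M E"
  shows "H \<inter> K \<in> corank_flats M 2"
proof -
  have fin: "finite (H \<inter> K)"
    using finite_ground assms(1) hyp_subset finite_subset by (metis finite_Int)
  have "mrank M L \<le> mrank M (H \<inter> K)" using rank_mono[OF fin assms(4)] .
  moreover have "\<not> mrank M E \<le> Suc (mrank M (H \<inter> K))"
    using hyp_eqI[OF finite_ground assms(1,2), of "H \<inter> K"] assms(3) by auto
  ultimately have "mrank M (H \<inter> K) + 2 = mrank M E" using assms(5) by simp
  moreover have "span (H \<inter> K) \<inter> E \<subseteq> H \<inter> K"
    using hyp_span_subset[OF finite_ground assms(1), of "H \<inter> K"]
      hyp_span_subset[OF finite_ground assms(2), of "H \<inter> K"] by blast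
  ultimately show ?thesis using hyp_subset[OF assms(1)] unfolding corank_flats_iff by blast
qed

text \<open>An element of \<open>H1\<close> and \<open>H2\<close> outside the span of
  \<open>L\<close> would make both of them the hyperplane through \<open>L\<close> and that
  element.\<close>

lemma Int_subset:
  assumes "hyp E H1" "hyp E H2" "H1 \<noteq> H2" "hyp E H3" "L \<subseteq> H1 \<inter> H2 \<inter> H3"
    "mrank M L + 2 = mrank M E"
  shows "H1 \<inter> H2 \<subseteq> H3"
proof
  fix x assume x: "x \<in> H1 \<inter> H2"
  have "x \<in> span L"
  proof (rule ccontr)
    assume "x \<notin> span L"
    then have "join E L x = H1" "join E L x = H2"
      using x assms(5,6)
      using join_eq[OF finite_ground assms(1), of L x] join_eq[OF finite_ground assms(2), of L x]
      by simp_all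
    then show False using assms(3) by simp
  qed
  then show "x \<in> H3"
    using hyp_span_subset[OF finite_ground assms(4), of L] assms(5) x hyp_subset[OF assms(1)] by auto
qed

end

section \<open>Pastures and representations\<close>

locale pasture_struct =
  fixes P :: "'a pasture" (structure)
  assumes pasture: "pasture P"
begin

abbreviation zero ("\<zero>") where "\<zero> \<equiv> pzero P"

abbreviation neg_one ("\<epsilon>") where "\<epsilon> \<equiv> pneg P \<one>"

sublocale comm_monoid P
  using pasture by (simp add: pasture_def pointed_group_def)

sublocale U: comm_group "units_of P"
  by (rule units_comm_group)

lemma zero_closed [simp, intro]: "\<zero> \<in> carrier P"
  and zero_neq_one: "\<zero> \<noteq> \<one>"
  and zero_mult [simp]: "x \<in> carrier P \<Longrightarrow> \<zero> \<otimes> x = \<zero>"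
  and nonzeros_subset: "nonzeros P \<subseteq> Units P"
  and null_set_subset: "null_set P \<subseteq> Sym3 P"
  and null_set_scale: "x \<in> carrier P \<Longrightarrow> m \<in> null_set P \<Longrightarrow> image_mset (\<lambda>y. x \<otimes> y) m \<in> null_set P"
  and negation_ex1: "a \<in> carrier P \<Longrightarrow> \<exists>!b. b \<in> carrier P \<and> {#a, b, \<zero>#} \<in> null_set P"
  using pasture by (simp_all add: pasture_def pointed_group_def)

lemma mult_zero [simp]: "x \<in> carrier P \<Longrightarrow> x \<otimes> \<zero> = \<zero>"
  using m_comm[of x \<zero>] by simp

lemma zero_not_unit: "\<zero> \<notin> Units P"
  using Units_r_inv[of \<zero>] Units_inv_closed[of \<zero>] zero_mult[of "inv \<zero>"] zero_neq_one by metis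

lemma nonzeros_eq_Units: "nonzeros P = Units P"
  using nonzeros_subset zero_not_unit by (auto simp: nonzeros_def)

lemma Units_iff: "x \<in> carrier P \<Longrightarrow> x \<in> Units P \<longleftrightarrow> x \<noteq> \<zero>"
  using nonzeros_eq_Units by (auto simp: nonzeros_def)

lemma mult_eq_zero_iff: "x \<in> carrier P \<Longrightarrow> y \<in> carrier P \<Longrightarrow> x \<otimes> y = \<zero> \<longleftrightarrow> x = \<zero> \<or> y = \<zero>"
  using Units_iff Units_m_closed[of x y] zero_not_unit by fastforce

lemma null_scale3:
  "x \<in> carrier P \<Longrightarrow> {#a, b, c#} \<in> null_set P \<Longrightarrow> {#x \<otimes> a, x \<otimes> b, x \<otimes> c#} \<in> null_set P"
  using null_set_scale[of x "{#a, b, c#}"] by simp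

lemma null_closed:
  "{#a, b, c#} \<in> null_set P \<Longrightarrow> a \<in> carrier P \<and> b \<in> carrier P \<and> c \<in> carrier P"
  using null_set_subset by (auto simp: Sym3_def)

lemma null_neg_one: "\<epsilon> \<in> carrier P" "{#\<one>, \<epsilon>, \<zero>#} \<in> null_set P"
  using theI'[OF negation_ex1[OF one_closed]] by (simp_all add: pneg_def)

lemma null_neg: "a \<in> carrier P \<Longrightarrow> {#a, \<epsilon> \<otimes> a, \<zero>#} \<in> null_set P"
  using null_scale3[OF _ null_neg_one(2), of a] null_neg_one(1) by (simp add: m_comm)

lemma null_pairD:
  assumes "{#a, b, \<zero>#} \<in> null_set P"
  shows "b = \<epsilon> \<otimes> a"
proof -
  have "a \<in> carrier P" "b \<in> carrier P" using null_closed[OF assms] by auto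
  then show ?thesis
    using assms null_neg[of a] negation_ex1[of a] null_neg_one(1) by blast
qed

lemma neg_one_unit: "\<epsilon> \<in> Units P"
proof -
  have "\<epsilon> \<noteq> \<zero>"
  proof
    assume "\<epsilon> = \<zero>"
    then have "{#\<zero>, \<one>, \<zero>#} \<in> null_set P" using null_neg_one(2) by (simp add: add_mset_commute)
    from null_pairD[OF this] show False using null_neg_one(1) zero_neq_one by simp
  qed
  then show ?thesis using Units_iff null_neg_one(1) by simp
qed

end

section \<open>Introduction and elimination rules for representations\<close>

lemma representationsI:
  assumes "\<phi> \<in> hyperplanes M \<rightarrow>\<^sub>E (ground M \<rightarrow>\<^sub>E carrier P)"
    and "\<And>H e. \<lbrakk>H \<in> hyperplanes M; e \<in> ground M\<rbrakk> \<Longrightarrow> \<phi> H e = pzero P \<longleftrightarrow> e \<in> H"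
    and "\<And>H1 H2 H3. \<lbrakk>H1 \<in> hyperplanes M; H2 \<in> hyperplanes M; H3 \<in> hyperplanes M;
      H1 \<noteq> H2; H1 \<noteq> H3; H2 \<noteq> H3; H1 \<inter> H2 \<inter> H3 \<in> corank_flats M 2\<rbrakk> \<Longrightarrow>
      \<exists>a\<in>carrier P. \<exists>b\<in>carrier P. \<exists>c\<in>carrier P. (a, b, c) \<noteq> (pzero P, pzero P, pzero P) \<and>
        (\<forall>e\<in>ground M. {#a \<otimes>\<^bsub>P\<^esub> \<phi> H1 e, b \<otimes>\<^bsub>P\<^esub> \<phi> H2 e, c \<otimes>\<^bsub>P\<^esub> \<phi> H3 e#} \<in> null_set P)"
  shows "\<phi> \<in> representations M P"
  unfolding representations_def mem_Collect_eq
proof (intro conjI)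
  show "\<phi> \<in> hyperplanes M \<rightarrow>\<^sub>E (ground M \<rightarrow>\<^sub>E carrier P)" by (rule assms(1))
  show "\<forall>H\<in>hyperplanes M. \<forall>e\<in>ground M. \<phi> H e = pzero P \<longleftrightarrow> e \<in> H"
    by (intro ballI) (rule assms(2))
qed (intro ballI impI, elim conjE, rule assms(3))

lemma
  assumes "\<phi> \<in> representations M P"
  shows representations_PiE: "\<phi> \<in> hyperplanes M \<rightarrow>\<^sub>E (ground M \<rightarrow>\<^sub>E carrier P)"
    and representations_eq_zero_iff:
      "\<lbrakk>H \<in> hyperplanes M; e \<in> ground M\<rbrakk> \<Longrightarrow> \<phi> H e = pzero P \<longleftrightarrow> e \<in> H"
    and representations_three_term: "\<lbrakk>H1 \<in> hyperplanes M; H2 \<in> hyperplanes M; H3 \<in> hyperplanes M;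
      H1 \<noteq> H2; H1 \<noteq> H3; H2 \<noteq> H3; H1 \<inter> H2 \<inter> H3 \<in> corank_flats M 2\<rbrakk> \<Longrightarrow>
      \<exists>a\<in>carrier P. \<exists>b\<in>carrier P. \<exists>c\<in>carrier P. (a, b, c) \<noteq> (pzero P, pzero P, pzero P) \<and>
        (\<forall>e\<in>ground M. {#a \<otimes>\<^bsub>P\<^esub> \<phi> H1 e, b \<otimes>\<^bsub>P\<^esub> \<phi> H2 e, c \<otimes>\<^bsub>P\<^esub> \<phi> H3 e#} \<in> null_set P)"
proof -
  note * = assms[unfolded representations_def mem_Collect_eq]
  show "\<phi> \<in> hyperplanes M \<rightarrow>\<^sub>E (ground M \<rightarrow>\<^sub>E carrier P)" by (rule *[THEN conjunct1])
  show "\<phi> H e = pzero P \<longleftrightarrow> e \<in> H" if "H \<in> hyperplanes M" "e \<in> ground M"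
    by (rule *[THEN conjunct2, THEN conjunct1, rule_format, OF that])
  show "\<exists>a\<in>carrier P. \<exists>b\<in>carrier P. \<exists>c\<in>carrier P. (a, b, c) \<noteq> (pzero P, pzero P, pzero P) \<and>
      (\<forall>e\<in>ground M. {#a \<otimes>\<^bsub>P\<^esub> \<phi> H1 e, b \<otimes>\<^bsub>P\<^esub> \<phi> H2 e, c \<otimes>\<^bsub>P\<^esub> \<phi> H3 e#} \<in> null_set P)"
    if "H1 \<in> hyperplanes M" "H2 \<in> hyperplanes M" "H3 \<in> hyperplanes M"
      "H1 \<noteq> H2" "H1 \<noteq> H3" "H2 \<noteq> H3" "H1 \<inter> H2 \<inter> H3 \<in> corank_flats M 2"
    by (rule *[THEN conjunct2, THEN conjunct2, rule_format, OF that(1-3)]) (use that(4-7) in simp)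
qed

lemma representations_closed:
  "\<phi> \<in> representations M P \<Longrightarrow> H \<in> hyperplanes M \<Longrightarrow> e \<in> ground M \<Longrightarrow> \<phi> H e \<in> carrier P"
  using representations_PiE PiE_mem by metis

locale matroid_representation = matroid_struct M + pasture_struct P
  for M :: "'e matroid" and P :: "'a pasture" (structure) +
  fixes \<phi> :: "'e set \<Rightarrow> 'e \<Rightarrow> 'a"
  assumes representation: "\<phi> \<in> representations M P"
begin

lemma rep_closed [intro]: "hyp E H \<Longrightarrow> e \<in> E \<Longrightarrow> \<phi> H e \<in> carrier P"
  using representations_closed[OF representation] hyperplanes_iff by blast

lemma rep_eq_zero_iff: "hyp E H \<Longrightarrow> e \<in> E \<Longrightarrow> \<phi> H e = \<zero> \<longleftrightarrow> e \<in> H"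
  using representations_eq_zero_iff[OF representation] hyperplanes_iff by blast

lemma rep_unit: "hyp E H \<Longrightarrow> e \<in> E - H \<Longrightarrow> \<phi> H e \<in> Units P"
  using rep_eq_zero_iff[of H e] rep_closed[of H e] Units_iff by simp

lemma three_term:
  assumes "hyp E H1" "hyp E H2" "hyp E H3" "H1 \<noteq> H2" "H1 \<noteq> H3" "H2 \<noteq> H3"
    and "H1 \<inter> H2 \<inter> H3 \<in> corank_flats M 2"
  obtains a b c where "a \<in> carrier P" "b \<in> carrier P" "c \<in> carrier P" "(a, b, c) \<noteq> (\<zero>, \<zero>, \<zero>)"
    "\<And>e. e \<in> E \<Longrightarrow> {#a \<otimes> \<phi> H1 e, b \<otimes> \<phi> H2 e, c \<otimes> \<phi> H3 e#} \<in> null_set P"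
proof -
  have "\<exists>a\<in>carrier P. \<exists>b\<in>carrier P. \<exists>c\<in>carrier P.
      (a, b, c) \<noteq> (\<zero>, \<zero>, \<zero>) \<and>
      (\<forall>e\<in>E. {#a \<otimes> \<phi> H1 e, b \<otimes> \<phi> H2 e, c \<otimes> \<phi> H3 e#} \<in> null_set P)"
    by (rule representations_three_term[OF representation]) (use assms hyperplanes_iff in simp_all)
  then show thesis using that by blast
qed

text \<open>The last three conjuncts are the relation at points of one of the hyperplanes: one term
  vanishes there, and the other two are negatives of each other.\<close>

definition three_term_units :: "'e set \<Rightarrow> 'e set \<Rightarrow> 'e set \<Rightarrow> 'a \<Rightarrow> 'a \<Rightarrow> 'a \<Rightarrow> bool" where
  "three_term_units H1 H2 H3 a b c \<longleftrightarrow> a \<in> Units P \<and> b \<in> Units P \<and> c \<in> Units P \<and>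
    (\<forall>e\<in>E. {#a \<otimes> \<phi> H1 e, b \<otimes> \<phi> H2 e, c \<otimes> \<phi> H3 e#} \<in> null_set P) \<and>
    (\<forall>e\<in>H3. b \<otimes> \<phi> H2 e = \<epsilon> \<otimes> (a \<otimes> \<phi> H1 e)) \<and>
    (\<forall>e\<in>H1. c \<otimes> \<phi> H3 e = \<epsilon> \<otimes> (b \<otimes> \<phi> H2 e)) \<and>
    (\<forall>e\<in>H2. a \<otimes> \<phi> H1 e = \<epsilon> \<otimes> (c \<otimes> \<phi> H3 e))"

lemma three_term_unitsD:
  assumes "three_term_units H1 H2 H3 a b c"
  shows "a \<in> Units P" "b \<in> Units P" "c \<in> Units P"
    "e \<in> E \<Longrightarrow> {#a \<otimes> \<phi> H1 e, b \<otimes> \<phi> H2 e, c \<otimes> \<phi> H3 e#} \<in> null_set P"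
    "e \<in> H3 \<Longrightarrow> b \<otimes> \<phi> H2 e = \<epsilon> \<otimes> (a \<otimes> \<phi> H1 e)"
    "e \<in> H1 \<Longrightarrow> c \<otimes> \<phi> H3 e = \<epsilon> \<otimes> (b \<otimes> \<phi> H2 e)"
    "e \<in> H2 \<Longrightarrow> a \<otimes> \<phi> H1 e = \<epsilon> \<otimes> (c \<otimes> \<phi> H3 e)"
  using assms by (simp_all only: three_term_units_def)

text \<open>The definition of a representation only says that the coefficients are not all zero. A
  point of \<open>H3\<close> outside \<open>H1\<close> is also outside \<open>H2\<close>, so the
  relation there makes \<open>a\<close> and \<open>b\<close> vanish together; a point of
  \<open>H1\<close> does the same for \<open>b\<close> and \<open>c\<close>.\<close>

lemma exists_three_term_units:
  assumes H: "hyp E H1" "hyp E H2" "hyp E H3" "H1 \<noteq> H2" "H1 \<noteq> H3" "H2 \<noteq> H3"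
    and L: "L \<subseteq> H1 \<inter> H2 \<inter> H3" "mrank M L + 2 = mrank M E"
  obtains a b c where "three_term_units H1 H2 H3 a b c"
proof -
  have "H1 \<inter> H2 \<subseteq> H3" by (rule Int_subset[OF H(1,2,4,3) L])
  then have "H1 \<inter> H2 \<inter> H3 = H1 \<inter> H2" by blast
  then have "H1 \<inter> H2 \<inter> H3 \<in> corank_flats M 2" using coline_Int[OF H(1,2,4) _ L(2)] L(1) by auto
  from three_term[OF H this] obtain a b c where c: "a \<in> carrier P" "b \<in> carrier P" "c \<in> carrier P"
    and nz: "(a, b, c) \<noteq> (\<zero>, \<zero>, \<zero>)"
    and null: "\<And>e. e \<in> E \<Longrightarrow> {#a \<otimes> \<phi> H1 e, b \<otimes> \<phi> H2 e, c \<otimes> \<phi> H3 e#} \<in> null_set P"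
    by metis
  note sub = hyp_subset[OF H(1)] hyp_subset[OF H(2)] hyp_subset[OF H(3)]
  have r3: "b \<otimes> \<phi> H2 e = \<epsilon> \<otimes> (a \<otimes> \<phi> H1 e)" if "e \<in> H3" for e
    by (rule null_pairD) (use null[of e] sub that rep_eq_zero_iff[OF H(3), of e] c in auto)
  have r1: "c \<otimes> \<phi> H3 e = \<epsilon> \<otimes> (b \<otimes> \<phi> H2 e)" if "e \<in> H1" for e
    by (rule null_pairD)
      (use null[of e] sub that rep_eq_zero_iff[OF H(1), of e] c in \<open>auto simp: add_mset_commute\<close>)
  have r2: "a \<otimes> \<phi> H1 e = \<epsilon> \<otimes> (c \<otimes> \<phi> H3 e)" if "e \<in> H2" for e
    by (rule null_pairD)
      (use null[of e] sub that rep_eq_zero_iff[OF H(2), of e] c in \<open>auto simp: add_mset_commute\<close>)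
  have zero_iff: "x \<otimes> \<phi> K e = \<zero> \<longleftrightarrow> x = \<zero>" if "x \<in> carrier P" "hyp E K" "e \<in> E" "e \<notin> K" for x K e
    using that mult_eq_zero_iff[OF that(1) rep_closed[OF that(2,3)]] rep_eq_zero_iff[OF that(2,3)] by simp
  obtain x where x: "x \<in> H3" "x \<notin> H1" using hyp_not_subset[OF H(3,1)] H(5) by blast
  have x': "x \<in> E" "x \<notin> H2" using x sub Int_subset[OF H(2,3,6,1) _ L(2)] L(1) by blast+
  obtain y where y: "y \<in> H1" "y \<notin> H2" using hyp_not_subset[OF H(1,2)] H(4) by blast
  have y': "y \<in> E" "y \<notin> H3" using y sub Int_subset[OF H(1,3,5,2) _ L(2)] L(1) by blast+
  have e: "\<epsilon> \<noteq> \<zero>" using neg_one_unit zero_not_unit by metis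
  have "b = \<zero> \<longleftrightarrow> a = \<zero>"
    using r3[OF x(1)] zero_iff[OF c(2) H(2) x'] zero_iff[OF c(1) H(1) x'(1) x(2)]
      mult_eq_zero_iff[OF null_neg_one(1), of "a \<otimes> \<phi> H1 x"] c rep_closed[OF H(1) x'(1)] e by simp
  moreover have "c = \<zero> \<longleftrightarrow> b = \<zero>"
    using r1[OF y(1)] zero_iff[OF c(3) H(3) y'] zero_iff[OF c(2) H(2) y'(1) y(2)]
      mult_eq_zero_iff[OF null_neg_one(1), of "b \<otimes> \<phi> H2 y"] c rep_closed[OF H(2) y'(1)] e by simp
  ultimately have u: "a \<in> Units P" "b \<in> Units P" "c \<in> Units P" using nz c Units_iff by auto
  have "three_term_units H1 H2 H3 a b c"
    unfolding three_term_units_def by (intro conjI ballI u null r1 r2 r3)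
  then show thesis by (rule that)
qed

text \<open>On \<open>H3\<close> the third term vanishes, so \<open>\<phi> H1\<close> and
  \<open>\<phi> H2\<close> are proportional there. This is what makes a cross-ratio independent of
  the points chosen in its third and fourth hyperplane.\<close>

lemma ratio:
  assumes H: "hyp E H1" "hyp E H2" "hyp E H3" "H1 \<noteq> H2" "H1 \<noteq> H3" "H2 \<noteq> H3"
    and L: "L \<subseteq> H1 \<inter> H2 \<inter> H3" "mrank M L + 2 = mrank M E" and e: "e \<in> H3" "e' \<in> H3"
  shows "\<phi> H1 e \<otimes> \<phi> H2 e' = \<phi> H1 e' \<otimes> \<phi> H2 e"
proof -
  obtain a b c where abc: "three_term_units H1 H2 H3 a b c"
    by (rule exists_three_term_units[OF H L])
  note u = three_term_unitsD(1-3)[OF abc] and r3 = three_term_unitsD(5)[OF abc]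
  have E: "e \<in> E" "e' \<in> E" using e hyp_subset[OF H(3)] by auto
  note c = rep_closed[OF H(1) E(1)] rep_closed[OF H(1) E(2)] rep_closed[OF H(2) E(1)]
    rep_closed[OF H(2) E(2)] Units_closed[OF u(1)] Units_closed[OF u(2)] null_neg_one(1)
  have "\<epsilon> \<otimes> a \<otimes> (b \<otimes> (\<phi> H1 e \<otimes> \<phi> H2 e')) = (\<epsilon> \<otimes> (a \<otimes> \<phi> H1 e)) \<otimes> (b \<otimes> \<phi> H2 e')"
    using c by (simp add: m_ac)
  also have "\<dots> = (b \<otimes> \<phi> H2 e) \<otimes> (\<epsilon> \<otimes> (a \<otimes> \<phi> H1 e'))"
    by (simp only: r3[OF e(1)] r3[OF e(2)])
  also have "\<dots> = \<epsilon> \<otimes> a \<otimes> (b \<otimes> (\<phi> H1 e' \<otimes> \<phi> H2 e))"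
    using c by (simp add: m_ac)
  finally show ?thesis
    using c u neg_one_unit by simp
qed

text \<open>At each of \<open>e1\<close>, \<open>e2\<close>, \<open>e3\<close> the three-term
  relation reduces to two terms. In the product of the three equations the coefficients cancel and
  one \<open>\<epsilon>\<close> per equation remains, harmless modulo a group containing
  \<open>\<epsilon>\<close>.\<close>

lemma hexagon:
  assumes H: "hyp E H1" "hyp E H2" "hyp E H3" and L: "L \<subseteq> H1 \<inter> H2 \<inter> H3" "mrank M L + 2 = mrank M E"
    and e: "e1 \<in> H1 - (H2 \<union> H3)" "e2 \<in> H2 - (H1 \<union> H3)" "e3 \<in> H3 - (H1 \<union> H2)"
  shows "\<phi> H1 e2 \<otimes> \<phi> H2 e3 \<otimes> \<phi> H3 e1 = (\<epsilon> \<otimes> \<epsilon> \<otimes> \<epsilon>) \<otimes> (\<phi> H1 e3 \<otimes> \<phi> H2 e1 \<otimes> \<phi> H3 e2)"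
proof -
  have neq: "H1 \<noteq> H2" "H1 \<noteq> H3" "H2 \<noteq> H3" using e by auto
  obtain a b c where abc: "three_term_units H1 H2 H3 a b c"
    by (rule exists_three_term_units[OF H neq L])
  note u = three_term_unitsD(1-3)[OF abc] and r3 = three_term_unitsD(5)[OF abc]
    and r1 = three_term_unitsD(6)[OF abc] and r2 = three_term_unitsD(7)[OF abc]
  have E: "e1 \<in> E" "e2 \<in> E" "e3 \<in> E" using e H hyp_subset by blast+
  note c = rep_closed[OF H(1) E(2)] rep_closed[OF H(1) E(3)] rep_closed[OF H(2) E(1)]
    rep_closed[OF H(2) E(3)] rep_closed[OF H(3) E(1)] rep_closed[OF H(3) E(2)]
    u[THEN Units_closed] null_neg_one(1)
  have "a \<otimes> b \<otimes> c \<otimes> (\<phi> H1 e2 \<otimes> \<phi> H2 e3 \<otimes> \<phi> H3 e1)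
      = (a \<otimes> \<phi> H1 e2) \<otimes> (b \<otimes> \<phi> H2 e3) \<otimes> (c \<otimes> \<phi> H3 e1)"
    using c by (simp add: m_ac)
  also have "\<dots> = (\<epsilon> \<otimes> (c \<otimes> \<phi> H3 e2)) \<otimes> (\<epsilon> \<otimes> (a \<otimes> \<phi> H1 e3)) \<otimes> (\<epsilon> \<otimes> (b \<otimes> \<phi> H2 e1))"
    using r1[of e1] r2[of e2] r3[of e3] e by simp
  also have "\<dots> = a \<otimes> b \<otimes> c \<otimes> ((\<epsilon> \<otimes> \<epsilon> \<otimes> \<epsilon>) \<otimes> (\<phi> H1 e3 \<otimes> \<phi> H2 e1 \<otimes> \<phi> H3 e2))"
    using c by (simp add: m_ac)
  finally show ?thesis
    using c u by simp
qed

section \<open>Cross-ratios and the subgroups containing them\<close>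

lemma cross_ratio_witness:
  assumes "(H1, H2, H3, H4) \<in> Theta M"
  obtains a b where "a \<in> H3" "a \<notin> H1" "a \<notin> H2" "b \<in> H4" "b \<notin> H1" "b \<notin> H2"
    "cross_ratio P \<phi> H1 H2 H3 H4 = (\<phi> H1 a \<otimes> \<phi> H2 b) \<otimes> inv (\<phi> H1 b \<otimes> \<phi> H2 a)"
proof -
  let ?L = "H1 \<inter> H2 \<inter> H3 \<inter> H4"
  have H: "hyp E H3" "hyp E H4" and L: "?L \<in> corank_flats M 2"
    and I: "?L = H1 \<inter> H3" "?L = H2 \<inter> H3" "?L = H1 \<inter> H4" "?L = H2 \<inter> H4"
    using assms by (auto simp: Theta_def Let_def hyperplanes_iff)
  have r: "mrank M ?L + 2 = mrank M E" using L corank_flats_iff by blast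
  define a where "a = (SOME x. x \<in> H3 - ?L)"
  define b where "b = (SOME x. x \<in> H4 - ?L)"
  have ne: "H - ?L \<noteq> {}" if "hyp E H" "?L \<subseteq> H" for H
    using r hyp_rank[OF that(1)] that(2) by (metis Diff_eq_empty_iff Suc_eq_plus1 Suc_n_not_n add_2_eq_Suc' subset_antisym)
  have a: "a \<in> H3 - ?L" unfolding a_def by (rule some_in_eq[THEN iffD2], rule ne[OF H(1)]) blast
  have b: "b \<in> H4 - ?L" unfolding b_def by (rule some_in_eq[THEN iffD2], rule ne[OF H(2)]) blast
  have "cross_ratio P \<phi> H1 H2 H3 H4 = (\<phi> H1 a \<otimes> \<phi> H2 b) \<otimes> inv (\<phi> H1 b \<otimes> \<phi> H2 a)"
    by (simp add: cross_ratio_def a_def b_def Let_def)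
  then show thesis using that[of a b] a b I by blast
qed

lemma cross_ratios_units: "cross_ratios M P \<phi> \<subseteq> Units P"
proof
  fix x assume "x \<in> cross_ratios M P \<phi>"
  then obtain H1 H2 H3 H4 where T: "(H1, H2, H3, H4) \<in> Theta M" and x: "x = cross_ratio P \<phi> H1 H2 H3 H4"
    by (auto simp: cross_ratios_def)
  have H: "hyp E H1" "hyp E H2" "hyp E H3" "hyp E H4"
    using T by (auto simp: Theta_def Let_def hyperplanes_iff)
  obtain a b where ab: "a \<in> H3" "a \<notin> H1" "a \<notin> H2" "b \<in> H4" "b \<notin> H1" "b \<notin> H2"
    and "cross_ratio P \<phi> H1 H2 H3 H4 = (\<phi> H1 a \<otimes> \<phi> H2 b) \<otimes> inv (\<phi> H1 b \<otimes> \<phi> H2 a)"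
    using cross_ratio_witness[OF T] .
  moreover have "a \<in> E" "b \<in> E" using ab H hyp_subset by blast+
  ultimately show "x \<in> Units P"
    using x H by (auto intro!: Units_m_closed Units_inv_Units rep_unit)
qed

text \<open>The third and fourth hyperplanes are those through \<open>L\<close> and \<open>e\<close>
  and through \<open>L\<close> and \<open>f\<close>. Their cross-ratio is evaluated at points picked
  by its definition; \<open>ratio\<close> carries it over to \<open>e\<close> and
  \<open>f\<close>.\<close>

lemma quad_mod_cross_ratio:
  assumes H: "hyp E H" "hyp E K" and L: "L \<subseteq> H \<inter> K" "mrank M L + 2 = mrank M E"
    and ef: "{e, f} \<subseteq> E - (H \<union> K)" and neq: "H \<noteq> K"
  shows "\<exists>s\<in>cross_ratios M P \<phi>. \<phi> H e \<otimes> \<phi> K f = s \<otimes> (\<phi> H f \<otimes> \<phi> K e)"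
proof -
  have LE: "L \<subseteq> E" using L H hyp_subset by blast
  have ef': "e \<in> E" "f \<in> E" "e \<notin> H" "e \<notin> K" "f \<notin> H" "f \<notin> K" using ef by auto
  have Ls: "e \<notin> span L" "f \<notin> span L"
    using hyp_span_subset[OF finite_ground H(1), of L] L(1) ef' by blast+
  note J = join_hyp[OF finite_ground LE L(2) ef'(1) Ls(1)]
  note K = join_hyp[OF finite_ground LE L(2) ef'(2) Ls(2)]
  \<comment> \<open>\<open>?K\<close> is the hyperplane through \<open>L\<close> and
    \<open>f\<close>, not the given \<open>K\<close>.\<close>
  let ?J = "join E L e" and ?K = "join E L f"
  have n: "H \<noteq> ?J" "K \<noteq> ?J" "H \<noteq> ?K" "K \<noteq> ?K" using J(3) K(3) ef' by auto
  have I: "H \<inter> K \<subseteq> ?J" "H \<inter> K \<subseteq> ?K" "H \<inter> ?J \<subseteq> K" "K \<inter> ?J \<subseteq> H" "H \<inter> ?K \<subseteq> K" "K \<inter> ?K \<subseteq> H"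
    using Int_subset[OF _ _ _ _ _ L(2)] H J(1,2) K(1,2) L(1) n neq by (meson Int_greatest le_infE)+
  have "H \<inter> K \<in> corank_flats M 2" by (rule coline_Int[OF H neq L])
  moreover have "H \<inter> K \<inter> ?J \<inter> ?K = H \<inter> K" using I by blast
  moreover have "H \<inter> K = H \<inter> ?J" "H \<inter> K = H \<inter> ?K" "H \<inter> K = K \<inter> ?J" "H \<inter> K = K \<inter> ?K" using I by blast+
  \<comment> \<open>\<open>?J\<close> and \<open>?K\<close> may coincide; \<open>Theta M\<close>
    admits such degenerate tuples.\<close>
  ultimately have T: "(H, K, ?J, ?K) \<in> Theta M"
    using H J(1) K(1) by (simp add: Theta_def Let_def hyperplanes_iff)
  obtain a b where ab: "a \<in> ?J" "a \<notin> H" "a \<notin> K" "b \<in> ?K" "b \<notin> H" "b \<notin> K"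
    and cr: "cross_ratio P \<phi> H K ?J ?K = (\<phi> H a \<otimes> \<phi> K b) \<otimes> inv (\<phi> H b \<otimes> \<phi> K a)"
    using cross_ratio_witness[OF T] .
  define s where "s = cross_ratio P \<phi> H K ?J ?K"
  have abE: "a \<in> E" "b \<in> E" using ab hyp_subset[OF J(1)] hyp_subset[OF K(1)] by auto
  have u: "\<phi> H a \<in> Units P" "\<phi> H b \<in> Units P" "\<phi> K a \<in> Units P" "\<phi> K b \<in> Units P"
    "\<phi> H e \<in> Units P" "\<phi> H f \<in> Units P" "\<phi> K e \<in> Units P" "\<phi> K f \<in> Units P"
    using rep_unit H ab abE ef' by auto
  note c = u[THEN Units_closed]
  have s: "s \<in> cross_ratios M P \<phi>" using T unfolding s_def cross_ratios_def by blast
  then have sc: "s \<in> carrier P" using cross_ratios_units by blast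
  have q: "s \<otimes> (\<phi> H b \<otimes> \<phi> K a) = \<phi> H a \<otimes> \<phi> K b"
    using u c unfolding s_def cr by (simp add: m_assoc)
  have rJ: "\<phi> H e \<otimes> \<phi> K a = \<phi> H a \<otimes> \<phi> K e"
    by (rule ratio[OF H J(1) neq n(1,2) _ L(2) J(3) ab(1)]) (use L J in auto)
  have rK: "\<phi> H f \<otimes> \<phi> K b = \<phi> H b \<otimes> \<phi> K f"
    by (rule ratio[OF H K(1) neq n(3,4) _ L(2) K(3) ab(4)]) (use L K in auto)
  have "(\<phi> K a \<otimes> \<phi> H b) \<otimes> (\<phi> H e \<otimes> \<phi> K f) = (\<phi> H e \<otimes> \<phi> K a) \<otimes> (\<phi> H b \<otimes> \<phi> K f)"
    using c by (simp add: m_ac)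
  also have "\<dots> = (\<phi> H a \<otimes> \<phi> K e) \<otimes> (\<phi> H f \<otimes> \<phi> K b)" by (simp add: rJ rK)
  also have "\<dots> = (\<phi> H a \<otimes> \<phi> K b) \<otimes> (\<phi> H f \<otimes> \<phi> K e)" using c by (simp add: m_ac)
  also have "\<dots> = (\<phi> K a \<otimes> \<phi> H b) \<otimes> (s \<otimes> (\<phi> H f \<otimes> \<phi> K e))"
    unfolding q[symmetric] using c sc by (simp add: m_ac)
  finally have "\<phi> H e \<otimes> \<phi> K f = s \<otimes> (\<phi> H f \<otimes> \<phi> K e)" using u c sc by simp
  then show ?thesis using s by blast
qed

lemma rescale_into_subgroup:
  assumes S: "subgroup S (units_of P)" "cross_ratios M P \<phi> \<subseteq> S" "\<epsilon> \<in> S"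
  obtains a t where "\<And>H. hyp E H \<Longrightarrow> a H \<in> Units P" "\<And>e. t e \<in> Units P"
    "\<And>H e. hyp E H \<Longrightarrow> e \<in> E - H \<Longrightarrow> a H \<otimes> t e \<otimes> \<phi> H e \<in> S"
proof -
  interpret S: subgroup S "units_of P" by fact
  have SU: "S \<subseteq> Units P" using S.subset by (simp add: units_of_carrier)
  obtain t where t: "\<And>f. t f \<in> carrier (units_of P)"
    "\<And>H f g. \<lbrakk>hyp E H; f \<in> E - H; g \<in> E - H\<rbrakk> \<Longrightarrow>
      \<phi> H f \<otimes>\<^bsub>units_of P\<^esub> t f \<otimes>\<^bsub>units_of P\<^esub> inv\<^bsub>units_of P\<^esub> (\<phi> H g \<otimes>\<^bsub>units_of P\<^esub> t g) \<in> S"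
  proof (rule exists_rescaling_mod_subgroup[OF U.comm_group_axioms S(1) finite_ground, of \<phi>])
    show "\<phi> H f \<in> carrier (units_of P)" if "hyp E H" "f \<in> E - H" for H f
      using rep_unit[OF that] by (simp add: units_of_carrier)
  next
    fix H K L e f
    assume a: "hyp E H" "hyp E K" "L \<subseteq> H \<inter> K" "mrank M L + 2 = mrank M E" "{e, f} \<subseteq> E - (H \<union> K)"
    show "\<exists>s\<in>S. \<phi> H e \<otimes>\<^bsub>units_of P\<^esub> \<phi> K f
        = s \<otimes>\<^bsub>units_of P\<^esub> (\<phi> H f \<otimes>\<^bsub>units_of P\<^esub> \<phi> K e)"
    proof (cases "H = K")
      case True
      then show ?thesis
        using a rep_closed[of H e] rep_closed[of H f] S.one_closed
        by (intro bexI[of _ \<one>]) (auto simp: units_of_mult units_of_one m_comm)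
    next
      case False
      then show ?thesis using quad_mod_cross_ratio[OF a] S(2) by (auto simp: units_of_mult)
    qed
  next
    fix H1 H2 H3 L e1 e2 e3
    assume a: "hyp E H1" "hyp E H2" "hyp E H3" "L \<subseteq> H1 \<inter> H2 \<inter> H3" "mrank M L + 2 = mrank M E"
      "e1 \<in> H1 - (H2 \<union> H3)" "e2 \<in> H2 - (H1 \<union> H3)" "e3 \<in> H3 - (H1 \<union> H2)"
    have "\<epsilon> \<otimes> \<epsilon> \<otimes> \<epsilon> \<in> S" using S(3) S.m_closed by (simp add: units_of_mult)
    then show "\<exists>s\<in>S. \<phi> H1 e2 \<otimes>\<^bsub>units_of P\<^esub> \<phi> H2 e3 \<otimes>\<^bsub>units_of P\<^esub> \<phi> H3 e1
        = s \<otimes>\<^bsub>units_of P\<^esub> (\<phi> H1 e3 \<otimes>\<^bsub>units_of P\<^esub> \<phi> H2 e1 \<otimes>\<^bsub>units_of P\<^esub> \<phi> H3 e2)"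
      using hexagon[OF a] by (auto simp: units_of_mult)
  qed (rule that)
  have tU: "t f \<in> Units P" for f using t(1)[of f] by (simp add: units_of_carrier)
  define g where "g H = (SOME f. f \<in> E - H)" for H
  \<comment> \<open>\<open>a H\<close> inverts the scaled label at one chosen element outside
    \<open>H\<close>. Every other scaled label of \<open>H\<close> differs from that one by an
    element of \<open>S\<close>.\<close>
  define a where "a H = inv (\<phi> H (g H) \<otimes> t (g H))" for H
  have g: "g H \<in> E - H" if "hyp E H" for H
    unfolding g_def using hyp_nonempty_compl[OF that] by (rule someI_ex)
  have u: "\<phi> H (g H) \<otimes> t (g H) \<in> Units P" if "hyp E H" for H
    using rep_unit[OF that g[OF that]] tU by simp
  show thesis
  proof (rule that[of a t])
    show "a H \<in> Units P" if "hyp E H" for H using u[OF that] by (simp add: a_def)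
    show "t e \<in> Units P" for e by (rule tU)
    show "a H \<otimes> t e \<otimes> \<phi> H e \<in> S" if H: "hyp E H" and e: "e \<in> E - H" for H e
    proof -
      have "a H \<otimes> t e \<otimes> \<phi> H e = \<phi> H e \<otimes> t e \<otimes> inv (\<phi> H (g H) \<otimes> t (g H))"
        using u[OF H] tU rep_unit[OF H e] by (simp add: a_def m_ac Units_closed)
      then show ?thesis
        using t(2)[OF H e g[OF H]] u[OF H] by (simp add: units_of_mult units_of_inv)
    qed
  qed
qed

end

section \<open>Subpastures and rescaling classes\<close>

text \<open>The null set is restricted in full: a null triple of \<open>P\<close> whose entries are
  zero or in \<open>S\<close> stays null.\<close>

definition subpasture :: "'a pasture \<Rightarrow> 'a set \<Rightarrow> 'a pasture" where
  "subpasture P S = P\<lparr>carrier := insert (pzero P) S,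
     null_set := {m \<in> null_set P. set_mset m \<subseteq> insert (pzero P) S}\<rparr>"

lemma subpasture_simps [simp]:
  "carrier (subpasture P S) = insert (pzero P) S"
  "monoid.mult (subpasture P S) = monoid.mult P"
  "one (subpasture P S) = one P"
  "pzero (subpasture P S) = pzero P"
  "null_set (subpasture P S) = {m \<in> null_set P. set_mset m \<subseteq> insert (pzero P) S}"
  by (simp_all add: subpasture_def)

context pasture_struct
begin

lemma subgroup_closed:
  assumes "subgroup S (units_of P)"
  shows "S \<subseteq> Units P" "\<one> \<in> S" "x \<in> S \<Longrightarrow> y \<in> S \<Longrightarrow> x \<otimes> y \<in> S" "x \<in> S \<Longrightarrow> inv x \<in> S"
proof -
  interpret S: subgroup S "units_of P" by fact
  show sub: "S \<subseteq> Units P" using S.subset by (simp add: units_of_carrier)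
  show "\<one> \<in> S" using S.one_closed by (simp add: units_of_one)
  show "x \<in> S \<Longrightarrow> y \<in> S \<Longrightarrow> x \<otimes> y \<in> S" using S.m_closed by (simp add: units_of_mult)
  show "x \<in> S \<Longrightarrow> inv x \<in> S" using S.m_inv_closed units_of_inv sub by (metis subsetD)
qed

text \<open>Negatives are where \<open>\<epsilon> \<in> S\<close> enters: the negative of
  \<open>a\<close> is \<open>\<epsilon> \<otimes> a\<close>, and restricting the null set keeps it
  unique.\<close>

lemma pasture_subpasture:
  assumes S: "subgroup S (units_of P)" "\<epsilon> \<in> S"
  shows "pasture (subpasture P S)"
proof -
  let ?Q = "subpasture P S"
  note S_closed = subgroup_closed[OF S(1)]
  have sub: "insert \<zero> S \<subseteq> carrier P" using S_closed(1) Units_closed by auto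
  have mult: "x \<otimes> y \<in> insert \<zero> S" if "x \<in> insert \<zero> S" "y \<in> insert \<zero> S" for x y
    using that S_closed(3) sub by auto
  have sub': "x \<in> carrier P" if "x \<in> carrier ?Q" for x using that sub by auto
  have cm: "comm_monoid ?Q"
  proof (rule comm_monoidI)
    show "x \<otimes>\<^bsub>?Q\<^esub> y \<in> carrier ?Q" if "x \<in> carrier ?Q" "y \<in> carrier ?Q" for x y
      using mult[of x y] that by simp
    show "\<one>\<^bsub>?Q\<^esub> \<in> carrier ?Q" using S_closed(2) by simp
    show "x \<otimes>\<^bsub>?Q\<^esub> y \<otimes>\<^bsub>?Q\<^esub> z = x \<otimes>\<^bsub>?Q\<^esub> (y \<otimes>\<^bsub>?Q\<^esub> z)"
      if "x \<in> carrier ?Q" "y \<in> carrier ?Q" "z \<in> carrier ?Q" for x y z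
      using m_assoc[OF sub'[OF that(1)] sub'[OF that(2)] sub'[OF that(3)]] by simp
    show "\<one>\<^bsub>?Q\<^esub> \<otimes>\<^bsub>?Q\<^esub> x = x" if "x \<in> carrier ?Q" for x
      using sub'[OF that] by simp
    show "x \<otimes>\<^bsub>?Q\<^esub> y = y \<otimes>\<^bsub>?Q\<^esub> x" if "x \<in> carrier ?Q" "y \<in> carrier ?Q" for x y
      using m_comm[OF sub'[OF that(1)] sub'[OF that(2)]] by simp
  qed
  have units: "nonzeros ?Q \<subseteq> Units ?Q"
  proof
    fix x assume "x \<in> nonzeros ?Q"
    then have x: "x \<in> S" by (simp add: nonzeros_def)
    then have "inv x \<otimes> x = \<one>" "x \<otimes> inv x = \<one>" using S_closed(1) by auto
    then show "x \<in> Units ?Q" using x S_closed(4)[OF x] by (auto simp: Units_def)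
  qed
  have "pointed_group ?Q"
    unfolding pointed_group_def using cm units zero_neq_one sub by auto
  moreover have "null_set ?Q \<subseteq> Sym3 ?Q" using null_set_subset by (auto simp: Sym3_def)
  moreover have "image_mset (\<lambda>y. x \<otimes>\<^bsub>?Q\<^esub> y) m \<in> null_set ?Q"
    if x: "x \<in> carrier ?Q" and m: "m \<in> null_set ?Q" for x m
  proof -
    have "x \<otimes> y \<in> insert \<zero> S" if "y \<in># m" for y
      by (rule mult) (use x m that in auto)
    then have "set_mset (image_mset (\<lambda>y. x \<otimes> y) m) \<subseteq> insert \<zero> S" by auto
    then show ?thesis using null_set_scale[OF sub'[OF x], of m] m by simp
  qed
  moreover have "\<exists>!b. b \<in> carrier ?Q \<and> {#a, b, pzero ?Q#} \<in> null_set ?Q" if "a \<in> carrier ?Q" for a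
  proof (rule ex1I)
    have "a \<in> carrier P" "a \<in> insert \<zero> S" using that sub by auto
    then show "\<epsilon> \<otimes> a \<in> carrier ?Q \<and> {#a, \<epsilon> \<otimes> a, pzero ?Q#} \<in> null_set ?Q"
      using null_neg[of a] mult[of \<epsilon> a] S(2) by simp
    show "b = \<epsilon> \<otimes> a" if "b \<in> carrier ?Q \<and> {#a, b, pzero ?Q#} \<in> null_set ?Q" for b
      using null_pairD[of a b] that by simp
  qed
  ultimately show ?thesis unfolding pasture_def by blast
qed

section \<open>Rescaling equivalence, and its behaviour under inclusion of a subpasture\<close>

lemma rescaling_relI:
  assumes "\<phi> \<in> representations M P" "\<phi>' \<in> representations M P"
    and "\<And>H. H \<in> hyperplanes M \<Longrightarrow> a H \<in> Units P" "\<And>e. e \<in> ground M \<Longrightarrow> t e \<in> Units P"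
    and "\<And>H e. H \<in> hyperplanes M \<Longrightarrow> e \<in> ground M \<Longrightarrow> \<phi>' H e = a H \<otimes> t e \<otimes> \<phi> H e"
  shows "(\<phi>, \<phi>') \<in> rescaling_rel M P"
proof -
  have "a \<in> hyperplanes M \<rightarrow> nonzeros P" "t \<in> ground M \<rightarrow> nonzeros P"
    using assms(3,4) nonzeros_eq_Units by auto
  then show ?thesis using assms(1,2,5) unfolding rescaling_rel_def by blast
qed

lemma rescaling_relE:
  assumes "(\<phi>, \<phi>') \<in> rescaling_rel M P"
  obtains a t where "\<phi> \<in> representations M P" "\<phi>' \<in> representations M P"
    "\<And>H. H \<in> hyperplanes M \<Longrightarrow> a H \<in> Units P" "\<And>e. e \<in> ground M \<Longrightarrow> t e \<in> Units P"
    "\<And>H e. H \<in> hyperplanes M \<Longrightarrow> e \<in> ground M \<Longrightarrow> \<phi>' H e = a H \<otimes> t e \<otimes> \<phi> H e"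
proof -
  have "\<exists>a\<in>hyperplanes M \<rightarrow> nonzeros P. \<exists>t\<in>ground M \<rightarrow> nonzeros P.
      \<forall>H\<in>hyperplanes M. \<forall>e\<in>ground M. \<phi>' H e = a H \<otimes> t e \<otimes> \<phi> H e"
    and rep: "\<phi> \<in> representations M P" "\<phi>' \<in> representations M P"
    using assms by (simp_all add: rescaling_rel_def)
  then obtain a t where at: "a \<in> hyperplanes M \<rightarrow> Units P" "t \<in> ground M \<rightarrow> Units P"
    and eq: "\<forall>H\<in>hyperplanes M. \<forall>e\<in>ground M. \<phi>' H e = a H \<otimes> t e \<otimes> \<phi> H e"
    unfolding nonzeros_eq_Units by (elim bexE)
  show thesis
    by (rule that[OF rep, of a t]) (simp_all add: eq funcset_mem[OF at(1)] funcset_mem[OF at(2)])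
qed

lemma rescaling_rel_refl: "\<phi> \<in> representations M P \<Longrightarrow> (\<phi>, \<phi>) \<in> rescaling_rel M P"
  by (rule rescaling_relI[where a = "\<lambda>_. \<one>" and t = "\<lambda>_. \<one>"]) (auto simp: representations_closed)

lemma rescaling_rel_sym:
  assumes "(\<phi>, \<phi>') \<in> rescaling_rel M P"
  shows "(\<phi>', \<phi>) \<in> rescaling_rel M P"
proof -
  obtain a t where rep: "\<phi> \<in> representations M P" "\<phi>' \<in> representations M P"
    and a: "\<And>H. H \<in> hyperplanes M \<Longrightarrow> a H \<in> Units P" and t: "\<And>e. e \<in> ground M \<Longrightarrow> t e \<in> Units P"
    and eq: "\<And>H e. H \<in> hyperplanes M \<Longrightarrow> e \<in> ground M \<Longrightarrow> \<phi>' H e = a H \<otimes> t e \<otimes> \<phi> H e"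
    using rescaling_relE[OF assms] by metis
  show ?thesis
  proof (rule rescaling_relI[OF rep(2,1), where a = "\<lambda>H. inv (a H)" and t = "\<lambda>e. inv (t e)"])
    fix H e assume H: "H \<in> hyperplanes M" and e: "e \<in> ground M"
    note c = a[OF H] t[OF e] representations_closed[OF rep(1) H e]
    have "inv (a H) \<otimes> inv (t e) \<otimes> \<phi>' H e = (inv (a H) \<otimes> a H) \<otimes> (inv (t e) \<otimes> t e) \<otimes> \<phi> H e"
      unfolding eq[OF H e] using c by (simp add: m_ac Units_closed del: Units_l_inv Units_r_inv)
    then show "\<phi> H e = inv (a H) \<otimes> inv (t e) \<otimes> \<phi>' H e" using c by simp
  qed (use a t in auto)
qed

lemma rescaling_rel_trans:
  assumes "(\<phi>, \<phi>') \<in> rescaling_rel M P" "(\<phi>', \<phi>'') \<in> rescaling_rel M P"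
  shows "(\<phi>, \<phi>'') \<in> rescaling_rel M P"
proof -
  obtain a t where rep: "\<phi> \<in> representations M P" "\<phi>' \<in> representations M P"
    and a: "\<And>H. H \<in> hyperplanes M \<Longrightarrow> a H \<in> Units P" and t: "\<And>e. e \<in> ground M \<Longrightarrow> t e \<in> Units P"
    and eq: "\<And>H e. H \<in> hyperplanes M \<Longrightarrow> e \<in> ground M \<Longrightarrow> \<phi>' H e = a H \<otimes> t e \<otimes> \<phi> H e"
    using rescaling_relE[OF assms(1)] by metis
  obtain b s where rep': "\<phi>'' \<in> representations M P"
    and b: "\<And>H. H \<in> hyperplanes M \<Longrightarrow> b H \<in> Units P" and s: "\<And>e. e \<in> ground M \<Longrightarrow> s e \<in> Units P"
    and eq': "\<And>H e. H \<in> hyperplanes M \<Longrightarrow> e \<in> ground M \<Longrightarrow> \<phi>'' H e = b H \<otimes> s e \<otimes> \<phi>' H e"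
    using rescaling_relE[OF assms(2)] by metis
  show ?thesis
  proof (rule rescaling_relI[OF rep(1) rep', where a = "\<lambda>H. b H \<otimes> a H" and t = "\<lambda>e. s e \<otimes> t e"])
    fix H e assume H: "H \<in> hyperplanes M" and e: "e \<in> ground M"
    show "\<phi>'' H e = b H \<otimes> a H \<otimes> (s e \<otimes> t e) \<otimes> \<phi> H e"
      using a[OF H] b[OF H] s[OF e] t[OF e] representations_closed[OF rep(1) H e]
      by (simp add: eq'[OF H e] eq[OF H e] m_ac Units_closed)
  qed (use a b s t in auto)
qed

lemma rescaling_class_eq:
  assumes "(\<phi>, \<phi>') \<in> rescaling_rel M P"
  shows "rescaling_rel M P `` {\<phi>} = rescaling_rel M P `` {\<phi>'}"
  using rescaling_rel_trans rescaling_rel_sym assms by blast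

lemma representations_subpasture:
  assumes S: "subgroup S (units_of P)"
  shows "representations M (subpasture P S) \<subseteq> representations M P"
proof
  fix \<phi> assume \<phi>: "\<phi> \<in> representations M (subpasture P S)"
  have sub: "insert \<zero> S \<subseteq> carrier P" using subgroup_closed(1)[OF S] Units_closed by auto
  show "\<phi> \<in> representations M P"
  proof (rule representationsI)
    have "(hyperplanes M \<rightarrow>\<^sub>E (ground M \<rightarrow>\<^sub>E insert \<zero> S)) \<subseteq> (hyperplanes M \<rightarrow>\<^sub>E (ground M \<rightarrow>\<^sub>E carrier P))"
      using sub by (intro PiE_mono)
    then show "\<phi> \<in> hyperplanes M \<rightarrow>\<^sub>E (ground M \<rightarrow>\<^sub>E carrier P)"
      using representations_PiE[OF \<phi>] by auto
    show "\<phi> H e = \<zero> \<longleftrightarrow> e \<in> H" if "H \<in> hyperplanes M" "e \<in> ground M" for H e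
      using representations_eq_zero_iff[OF \<phi> that] by simp
    fix H1 H2 H3
    assume H: "H1 \<in> hyperplanes M" "H2 \<in> hyperplanes M" "H3 \<in> hyperplanes M"
      "H1 \<noteq> H2" "H1 \<noteq> H3" "H2 \<noteq> H3" "H1 \<inter> H2 \<inter> H3 \<in> corank_flats M 2"
    let ?Q = "subpasture P S"
    obtain a b c where abc: "a \<in> carrier ?Q" "b \<in> carrier ?Q" "c \<in> carrier ?Q"
        "(a, b, c) \<noteq> (pzero ?Q, pzero ?Q, pzero ?Q)"
      and null: "\<forall>e\<in>ground M. {#a \<otimes>\<^bsub>?Q\<^esub> \<phi> H1 e, b \<otimes>\<^bsub>?Q\<^esub> \<phi> H2 e, c \<otimes>\<^bsub>?Q\<^esub> \<phi> H3 e#} \<in> null_set ?Q"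
      using representations_three_term[OF \<phi> H] by (elim bexE conjE)
    show "\<exists>a\<in>carrier P. \<exists>b\<in>carrier P. \<exists>c\<in>carrier P. (a, b, c) \<noteq> (\<zero>, \<zero>, \<zero>) \<and>
      (\<forall>e\<in>ground M. {#a \<otimes> \<phi> H1 e, b \<otimes> \<phi> H2 e, c \<otimes> \<phi> H3 e#} \<in> null_set P)"
    proof (intro bexI conjI ballI)
      show "(a, b, c) \<noteq> (\<zero>, \<zero>, \<zero>)" using abc(4) by simp
      show "{#a \<otimes> \<phi> H1 e, b \<otimes> \<phi> H2 e, c \<otimes> \<phi> H3 e#} \<in> null_set P" if "e \<in> ground M" for e
        using null that by simp
    qed (use abc sub in auto)
  qed
qed

lemma rescaling_rel_subpasture:
  assumes S: "subgroup S (units_of P)" and rel: "(\<phi>, \<phi>') \<in> rescaling_rel M (subpasture P S)"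
  shows "(\<phi>, \<phi>') \<in> rescaling_rel M P"
proof -
  have "nonzeros (subpasture P S) \<subseteq> nonzeros P"
    using subgroup_closed(1)[OF S] Units_closed by (auto simp: nonzeros_def)
  then show ?thesis
    using rel representations_subpasture[OF S, of M] unfolding rescaling_rel_def
    by (simp add: Pi_iff subset_iff) blast
qed

lemma inclusion_hom:
  assumes S: "subgroup S (units_of P)"
  shows "(\<lambda>x\<in>carrier (subpasture P S). x) \<in> pasture_hom (subpasture P S) P"
proof -
  have "insert \<zero> S \<subseteq> carrier P" using subgroup_closed(1)[OF S] Units_closed by auto
  moreover have "x \<otimes> y \<in> insert \<zero> S" if "x \<in> insert \<zero> S" "y \<in> insert \<zero> S" for x y
    using that calculation subgroup_closed(3)[OF S] by auto
  ultimately show ?thesis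
    using subgroup_closed(2)[OF S] unfolding pasture_hom_def by (simp add: subset_iff)
qed

lemma push_inclusion:
  assumes "\<phi> \<in> representations M (subpasture P S)"
  shows "push_representation M (\<lambda>x\<in>carrier (subpasture P S). x) \<phi> = \<phi>"
proof -
  have \<phi>: "\<phi> \<in> hyperplanes M \<rightarrow>\<^sub>E (ground M \<rightarrow>\<^sub>E insert \<zero> S)"
    using representations_PiE[OF assms] by simp
  show ?thesis
  proof (intro ext)
    fix H e
    show "push_representation M (\<lambda>x\<in>carrier (subpasture P S). x) \<phi> H e = \<phi> H e"
    proof (cases "H \<in> hyperplanes M")
      case True
      then have "\<phi> H \<in> ground M \<rightarrow>\<^sub>E insert \<zero> S" using \<phi> by auto
      then show ?thesis using True
        by (cases "e \<in> ground M") (auto simp: push_representation_def PiE_iff extensional_def)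
    next
      case False
      then have "\<phi> H = undefined" using \<phi> by (auto simp: PiE_iff extensional_def)
      then show ?thesis using False by (simp add: push_representation_def)
    qed
  qed
qed

lemma push_class_inclusion:
  assumes S: "subgroup S (units_of P)" "\<epsilon> \<in> S" and \<phi>: "\<phi> \<in> representations M (subpasture P S)"
  shows "push_class M P (\<lambda>x\<in>carrier (subpasture P S). x) (rescaling_rel M (subpasture P S) `` {\<phi>})
    = rescaling_rel M P `` {\<phi>}"
proof -
  interpret Q: pasture_struct "subpasture P S" using pasture_subpasture[OF S] by unfold_locales
  let ?C = "rescaling_rel M (subpasture P S) `` {\<phi>}"
  have reps: "\<psi> \<in> representations M (subpasture P S)" if "\<psi> \<in> ?C" for \<psi>
    using that by (simp add: rescaling_rel_def)
  then have "push_representation M (\<lambda>x\<in>carrier (subpasture P S). x) ` ?C = ?C"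
    using image_cong[OF refl push_inclusion[OF reps], of ?C] by simp
  then have "push_class M P (\<lambda>x\<in>carrier (subpasture P S). x) ?C = rescaling_rel M P `` ?C"
    by (simp add: push_class_def)
  moreover have "\<phi> \<in> ?C" using Q.rescaling_rel_refl[OF \<phi>] by simp
  moreover have "?C \<subseteq> rescaling_rel M P `` {\<phi>}" using rescaling_rel_subpasture[OF S(1)] by blast
  ultimately show ?thesis using rescaling_rel_trans by blast
qed

end

context matroid_representation
begin

text \<open>In a three-term relation the factors \<open>a H\<close> are absorbed by the
  coefficients, while \<open>t e\<close> is common to all three terms.\<close>

lemma rescaled_representation:
  assumes a: "\<And>H. hyp E H \<Longrightarrow> a H \<in> Units P" and t: "\<And>e. e \<in> E \<Longrightarrow> t e \<in> Units P"
  shows "(\<lambda>H\<in>hyperplanes M. \<lambda>e\<in>E. a H \<otimes> t e \<otimes> \<phi> H e) \<in> representations M P"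
    (is "?\<phi>' \<in> _")
proof -
  have eq: "?\<phi>' H e = a H \<otimes> t e \<otimes> \<phi> H e" if "hyp E H" "e \<in> E" for H e
    using that by (simp add: hyperplanes_iff)
  show ?thesis
  proof (rule representationsI)
    show "?\<phi>' \<in> hyperplanes M \<rightarrow>\<^sub>E (E \<rightarrow>\<^sub>E carrier P)"
      using a t rep_closed by (auto simp: hyperplanes_iff Units_closed)
    show "?\<phi>' H e = \<zero> \<longleftrightarrow> e \<in> H" if H: "H \<in> hyperplanes M" and e: "e \<in> E" for H e
    proof -
      have h: "hyp E H" using H by (simp add: hyperplanes_iff)
      have "a H \<otimes> t e \<in> Units P" using a[OF h] t[OF e] by simp
      then have "a H \<otimes> t e \<in> carrier P" "a H \<otimes> t e \<noteq> \<zero>" using zero_not_unit Units_closed by auto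
      then show ?thesis
        unfolding eq[OF h e] using mult_eq_zero_iff rep_closed[OF h e] rep_eq_zero_iff[OF h e] by simp
    qed
    show "\<exists>x\<in>carrier P. \<exists>y\<in>carrier P. \<exists>z\<in>carrier P. (x, y, z) \<noteq> (\<zero>, \<zero>, \<zero>) \<and>
        (\<forall>e\<in>E. {#x \<otimes> ?\<phi>' H1 e, y \<otimes> ?\<phi>' H2 e, z \<otimes> ?\<phi>' H3 e#} \<in> null_set P)"
      if "H1 \<in> hyperplanes M" "H2 \<in> hyperplanes M" "H3 \<in> hyperplanes M"
        and d: "H1 \<noteq> H2" "H1 \<noteq> H3" "H2 \<noteq> H3" "H1 \<inter> H2 \<inter> H3 \<in> corank_flats M 2" for H1 H2 H3
    proof -
      have H: "hyp E H1" "hyp E H2" "hyp E H3" using that by (simp_all add: hyperplanes_iff)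
      obtain x y z where c: "x \<in> carrier P" "y \<in> carrier P" "z \<in> carrier P" "(x, y, z) \<noteq> (\<zero>, \<zero>, \<zero>)"
        and null: "\<And>e. e \<in> E \<Longrightarrow> {#x \<otimes> \<phi> H1 e, y \<otimes> \<phi> H2 e, z \<otimes> \<phi> H3 e#} \<in> null_set P"
        using three_term[OF H d] by metis
      have move: "(x \<otimes> inv (a H)) \<otimes> ?\<phi>' H e = t e \<otimes> (x \<otimes> \<phi> H e)"
        if "hyp E H" "e \<in> E" "x \<in> carrier P" for x H e
      proof -
        have "(x \<otimes> inv (a H)) \<otimes> ?\<phi>' H e = (inv (a H) \<otimes> a H) \<otimes> (t e \<otimes> (x \<otimes> \<phi> H e))"
          unfolding eq[OF that(1,2)] using that a[OF that(1)] t[OF that(2)] rep_closed[OF that(1,2)]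
          by (simp add: m_ac Units_closed del: Units_l_inv Units_r_inv)
        then show ?thesis using that a[OF that(1)] t[OF that(2)] rep_closed[OF that(1,2)]
          by (simp add: Units_closed)
      qed
      have nz: "x \<otimes> inv (a H) = \<zero> \<longleftrightarrow> x = \<zero>" if "hyp E H" "x \<in> carrier P" for x H
      proof -
        have "inv (a H) \<noteq> \<zero>" using Units_inv_Units[OF a[OF that(1)]] zero_not_unit by metis
        then show ?thesis using mult_eq_zero_iff[OF that(2), of "inv (a H)"] a[OF that(1)] by simp
      qed
      show ?thesis
      proof (intro bexI conjI ballI)
        show "(x \<otimes> inv (a H1), y \<otimes> inv (a H2), z \<otimes> inv (a H3)) \<noteq> (\<zero>, \<zero>, \<zero>)"
          using c nz H by simp
        show "{#(x \<otimes> inv (a H1)) \<otimes> ?\<phi>' H1 e, (y \<otimes> inv (a H2)) \<otimes> ?\<phi>' H2 e,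
            (z \<otimes> inv (a H3)) \<otimes> ?\<phi>' H3 e#} \<in> null_set P" if "e \<in> E" for e
          unfolding move[OF H(1) that c(1)] move[OF H(2) that c(2)] move[OF H(3) that c(3)]
          using null_scale3 null[OF that] t[OF that] Units_closed by blast
      qed (use c a H in auto)
    qed
  qed
qed

text \<open>The coefficients of the three-term relations must lie in \<open>S\<close> as well. After
  division by \<open>a\<close> they are \<open>\<one>\<close> and two quotients, each of which can
  be read off at a point where only two terms survive, as \<open>\<epsilon>\<close> or its inverse
  times a quotient of values of \<open>\<phi>\<close>.\<close>

lemma representation_subpasture:
  assumes S: "subgroup S (units_of P)" "\<epsilon> \<in> S" and vals: "\<And>H e. hyp E H \<Longrightarrow> e \<in> E - H \<Longrightarrow> \<phi> H e \<in> S"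
  shows "\<phi> \<in> representations M (subpasture P S)"
proof -
  let ?Q = "subpasture P S"
  note S_closed = subgroup_closed[OF S(1)]
  have sub: "insert \<zero> S \<subseteq> carrier P" using S_closed(1) Units_closed by auto
  have vals': "\<phi> H e \<in> insert \<zero> S" if "hyp E H" "e \<in> E" for H e
    using vals[of H e] rep_eq_zero_iff[of H e] that by auto
  have "\<phi> \<in> hyperplanes M \<rightarrow>\<^sub>E (E \<rightarrow>\<^sub>E carrier P)"
    by (rule representations_PiE[OF representation])
  then have PiE: "\<phi> \<in> hyperplanes M \<rightarrow>\<^sub>E (E \<rightarrow>\<^sub>E carrier ?Q)"
    using vals' by (simp add: PiE_iff hyperplanes_iff)
  show ?thesis
  proof (rule representationsI)
    show "\<phi> \<in> hyperplanes M \<rightarrow>\<^sub>E (E \<rightarrow>\<^sub>E carrier ?Q)" by (rule PiE)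
    show "\<phi> H e = pzero ?Q \<longleftrightarrow> e \<in> H" if "H \<in> hyperplanes M" "e \<in> E" for H e
      using rep_eq_zero_iff that by (simp add: hyperplanes_iff)
    show "\<exists>x\<in>carrier ?Q. \<exists>y\<in>carrier ?Q. \<exists>z\<in>carrier ?Q. (x, y, z) \<noteq> (pzero ?Q, pzero ?Q, pzero ?Q) \<and>
        (\<forall>e\<in>E. {#x \<otimes>\<^bsub>?Q\<^esub> \<phi> H1 e, y \<otimes>\<^bsub>?Q\<^esub> \<phi> H2 e, z \<otimes>\<^bsub>?Q\<^esub> \<phi> H3 e#} \<in> null_set ?Q)"
      if "H1 \<in> hyperplanes M" "H2 \<in> hyperplanes M" "H3 \<in> hyperplanes M"
        and d: "H1 \<noteq> H2" "H1 \<noteq> H3" "H2 \<noteq> H3" "H1 \<inter> H2 \<inter> H3 \<in> corank_flats M 2" for H1 H2 H3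
    proof -
      have H: "hyp E H1" "hyp E H2" "hyp E H3" using that by (simp_all add: hyperplanes_iff)
      have L: "H1 \<inter> H2 \<inter> H3 \<subseteq> H1 \<inter> H2 \<inter> H3" "mrank M (H1 \<inter> H2 \<inter> H3) + 2 = mrank M E"
        using d corank_flats_iff by auto
      obtain a b c where abc: "three_term_units H1 H2 H3 a b c"
        by (rule exists_three_term_units[OF H d(1-3) L])
      note u = three_term_unitsD(1-3)[OF abc]
      note cl = u[THEN Units_closed]
      obtain x where x: "x \<in> H3" "x \<notin> H1" using hyp_not_subset[OF H(3,1)] d by blast
      have x': "x \<in> E" "x \<notin> H2"
        using x hyp_subset[OF H(3)] Int_subset[OF H(2,3) d(3) H(1) _ L(2)] by blast+
      obtain y where y: "y \<in> H2" "y \<notin> H1" using hyp_not_subset[OF H(2,1)] d by blast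
      have y': "y \<in> E" "y \<notin> H3"
        using y hyp_subset[OF H(2)] Int_subset[OF H(2,3) d(3) H(1) _ L(2)] by blast+
      have quotient: "p \<in> S" if "p \<in> carrier P" "q \<in> S" "p \<otimes> q \<in> S" for p q
      proof -
        have q: "q \<in> Units P" using S_closed(1) that by blast
        have "p = p \<otimes> q \<otimes> inv q" using that q by (simp add: m_assoc Units_closed)
        then show ?thesis using S_closed(3)[OF that(3) S_closed(4)[OF that(2)]] by simp
      qed
      have in_S: "\<phi> H1 x \<in> S" "\<phi> H2 x \<in> S" "\<phi> H1 y \<in> S" "\<phi> H3 y \<in> S"
        using vals H x x' y y' by auto
      then have in_P: "\<phi> H1 x \<in> carrier P" "\<phi> H2 x \<in> carrier P" "\<phi> H1 y \<in> carrier P" "\<phi> H3 y \<in> carrier P"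
        using sub by auto
      have bS: "inv a \<otimes> b \<in> S"
      proof (rule quotient[of _ "\<phi> H2 x"])
        have "inv a \<otimes> b \<otimes> \<phi> H2 x = inv a \<otimes> (\<epsilon> \<otimes> (a \<otimes> \<phi> H1 x))"
          using three_term_unitsD(5)[OF abc x(1)] u cl in_P by (simp add: m_assoc)
        also have "\<dots> = (inv a \<otimes> a) \<otimes> (\<epsilon> \<otimes> \<phi> H1 x)"
          using u(1) cl in_P null_neg_one(1) by (simp add: m_ac del: Units_l_inv Units_r_inv)
        also have "\<dots> = \<epsilon> \<otimes> \<phi> H1 x" using u in_P null_neg_one(1) by simp
        finally show "inv a \<otimes> b \<otimes> \<phi> H2 x \<in> S" using S_closed(3)[OF S(2) in_S(1)] by simp
      qed (use u cl in_S in auto)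
      have cS: "inv a \<otimes> c \<in> S"
      proof (rule quotient[of _ "\<epsilon> \<otimes> \<phi> H3 y"])
        have "inv a \<otimes> c \<otimes> (\<epsilon> \<otimes> \<phi> H3 y) = inv a \<otimes> (\<epsilon> \<otimes> (c \<otimes> \<phi> H3 y))"
          using u(1) cl in_P null_neg_one(1) by (simp add: m_ac)
        also have "\<dots> = inv a \<otimes> (a \<otimes> \<phi> H1 y)" using three_term_unitsD(7)[OF abc y(1)] by simp
        also have "\<dots> = \<phi> H1 y" using u(1) cl in_P by (simp add: m_assoc[symmetric])
        finally show "inv a \<otimes> c \<otimes> (\<epsilon> \<otimes> \<phi> H3 y) \<in> S" using in_S by simp
        show "\<epsilon> \<otimes> \<phi> H3 y \<in> S" using S_closed(3)[OF S(2) in_S(4)] .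
      qed (use u cl in auto)
      show ?thesis
      proof (intro bexI conjI ballI)
        show "(\<one>, inv a \<otimes> b, inv a \<otimes> c) \<noteq> (pzero ?Q, pzero ?Q, pzero ?Q)" using zero_neq_one by simp
        show "{#\<one> \<otimes>\<^bsub>?Q\<^esub> \<phi> H1 e, (inv a \<otimes> b) \<otimes>\<^bsub>?Q\<^esub> \<phi> H2 e, (inv a \<otimes> c) \<otimes>\<^bsub>?Q\<^esub> \<phi> H3 e#} \<in> null_set ?Q"
          if e: "e \<in> E" for e
        proof -
          note cp = rep_closed[OF H(1) e] rep_closed[OF H(2) e] rep_closed[OF H(3) e]
          have "{#inv a \<otimes> (a \<otimes> \<phi> H1 e), inv a \<otimes> (b \<otimes> \<phi> H2 e), inv a \<otimes> (c \<otimes> \<phi> H3 e)#} \<in> null_set P"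
            using null_scale3 three_term_unitsD(4)[OF abc e] u(1) by blast
          then have "{#\<one> \<otimes> \<phi> H1 e, (inv a \<otimes> b) \<otimes> \<phi> H2 e, (inv a \<otimes> c) \<otimes> \<phi> H3 e#} \<in> null_set P"
            using u(1) cl cp by (simp add: m_assoc[symmetric])
          moreover have "s \<otimes> \<phi> H e \<in> insert \<zero> S" if "s \<in> S" "hyp E H" for s H
            using vals'[OF that(2) e] S_closed(1,3) that(1) Units_closed by auto
          ultimately show ?thesis using bS cS S_closed(2) H by simp
        qed
      qed (use bS cS S_closed(2) in auto)
    qed
  qed
qed

end

section \<open>The Yoneda argument\<close>

theorem theorem2p28:
  fixes M :: "'e matroid"
    and F :: "'a pasture"
    and \<Phi> :: "'a pasture \<Rightarrow> ('a \<Rightarrow> 'a) \<Rightarrow> ('e set \<Rightarrow> 'e \<Rightarrow> 'a) set"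
    and \<phi> :: "'e set \<Rightarrow> 'e \<Rightarrow> 'a"
  assumes "matroid M"
    and "is_foundation M F \<Phi>"
    and "universal_representation M F \<Phi> \<phi>"
  shows "pasture_generated_by F (cross_ratios M F \<phi>)"
proof -
  have F: "pasture F" and \<phi>: "\<phi> \<in> representations M F"
    and univ: "rescaling_rel M F `` {\<phi>} = \<Phi> F (\<lambda>x\<in>carrier F. x)"
    and bij: "\<And>P. pasture P \<Longrightarrow> bij_betw (\<Phi> P) (pasture_hom F P) (rescaling_classes M P)"
    and natural: "\<And>P Q g h. \<lbrakk>pasture P; pasture Q; g \<in> pasture_hom F P; h \<in> pasture_hom P Q\<rbrakk> \<Longrightarrow>
      \<Phi> Q (compose (carrier F) h g) = push_class M Q h (\<Phi> P g)"
    using assms(2,3) by (simp_all add: is_foundation_def universal_representation_def)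
  interpret matroid_representation M F \<phi>
    using assms(1) F \<phi> by unfold_locales
  define S where "S = generate (units_of F) (cross_ratios M F \<phi> \<union> {pneg F \<one>\<^bsub>F\<^esub>})"
  have gens: "cross_ratios M F \<phi> \<union> {pneg F \<one>\<^bsub>F\<^esub>} \<subseteq> carrier (units_of F)"
    using cross_ratios_units neg_one_unit by (simp add: units_of_carrier)
  have S: "subgroup S (units_of F)" unfolding S_def by (rule U.generate_is_subgroup[OF gens])
  have incl: "cross_ratios M F \<phi> \<subseteq> S" "pneg F \<one>\<^bsub>F\<^esub> \<in> S"
    unfolding S_def by (auto intro: generate.incl)
  \<comment> \<open>\<open>is_foundation\<close> only tests pastures carried by the type
    \<open>'a\<close>. A subpasture of \<open>F\<close> lives on that type, so the universal
    property applies to it.\<close>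
  let ?Q = "subpasture F S"
  let ?\<iota> = "\<lambda>x\<in>carrier ?Q. x"
  have Q: "pasture ?Q" by (rule pasture_subpasture[OF S incl(2)])
  obtain a t where a: "\<And>H. hyp E H \<Longrightarrow> a H \<in> Units F" and t: "\<And>e. t e \<in> Units F"
    and in_S: "\<And>H e. hyp E H \<Longrightarrow> e \<in> E - H \<Longrightarrow> a H \<otimes>\<^bsub>F\<^esub> t e \<otimes>\<^bsub>F\<^esub> \<phi> H e \<in> S"
    using rescale_into_subgroup[OF S incl] by metis
  define \<phi>' where "\<phi>' = (\<lambda>H\<in>hyperplanes M. \<lambda>e\<in>E. a H \<otimes>\<^bsub>F\<^esub> t e \<otimes>\<^bsub>F\<^esub> \<phi> H e)"
  have \<phi>'F: "\<phi>' \<in> representations M F"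
    unfolding \<phi>'_def by (rule rescaled_representation[OF a t])
  interpret R: matroid_representation M F \<phi>' using \<phi>'F by unfold_locales
  have \<phi>'Q: "\<phi>' \<in> representations M ?Q"
    by (rule R.representation_subpasture[OF S incl(2)])
      (use in_S in \<open>auto simp: \<phi>'_def hyperplanes_iff\<close>)
  have rel: "(\<phi>, \<phi>') \<in> rescaling_rel M F"
    by (rule rescaling_relI[OF \<phi> \<phi>'F, of a t]) (use a t in \<open>auto simp: \<phi>'_def hyperplanes_iff\<close>)
  have "rescaling_rel M ?Q `` {\<phi>'} \<in> rescaling_classes M ?Q"
    unfolding rescaling_classes_def by (rule quotientI[OF \<phi>'Q])
  \<comment> \<open>Surjectivity of \<open>\<Phi> ?Q\<close> yields \<open>g\<close>. Injectivity of
    \<open>\<Phi> F\<close> will identify \<open>g\<close> followed by the inclusion with the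
    identity, since both give the class of \<open>\<phi>\<close>.\<close>
  then obtain g where g: "g \<in> pasture_hom F ?Q" "\<Phi> ?Q g = rescaling_rel M ?Q `` {\<phi>'}"
    using bij[OF Q] unfolding bij_betw_def by (metis imageE)
  have "\<Phi> F (compose (carrier F) ?\<iota> g) = push_class M F ?\<iota> (\<Phi> ?Q g)"
    by (rule natural[OF Q F g(1) inclusion_hom[OF S]])
  also have "\<dots> = rescaling_rel M F `` {\<phi>'}"
    unfolding g(2) by (rule push_class_inclusion[OF S incl(2) \<phi>'Q])
  also have "\<dots> = \<Phi> F (\<lambda>x\<in>carrier F. x)"
    using rescaling_class_eq[OF rel] univ by simp
  finally have eq: "\<Phi> F (compose (carrier F) ?\<iota> g) = \<Phi> F (\<lambda>x\<in>carrier F. x)" .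
  have g_closed: "g x \<in> carrier ?Q" if "x \<in> carrier F" for x
    using g(1) that by (auto simp: pasture_hom_def)
  have sub: "carrier ?Q \<subseteq> carrier F" using subgroup_closed(1)[OF S] Units_closed by auto
  have comp_eq: "compose (carrier F) ?\<iota> g = (\<lambda>x\<in>carrier F. g x)"
    using g_closed by (auto simp: compose_def fun_eq_iff)
  have "g \<in> carrier F \<rightarrow> carrier F" using g_closed sub by blast
  then have comp: "compose (carrier F) ?\<iota> g \<in> pasture_hom F F"
    unfolding comp_eq using g(1) by (simp add: pasture_hom_def)
  have id: "(\<lambda>x\<in>carrier F. x) \<in> pasture_hom F F" by (simp add: pasture_hom_def)
  have "compose (carrier F) ?\<iota> g = (\<lambda>x\<in>carrier F. x)"
    using bij[OF F] eq comp id unfolding bij_betw_def by (meson inj_onD)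
  then have "(\<lambda>x\<in>carrier F. g x) = (\<lambda>x\<in>carrier F. x)" unfolding comp_eq .
  \<comment> \<open>\<open>g\<close> is the identity on the carrier of \<open>F\<close>, yet takes
    its values in \<open>S\<close> and zero.\<close>
  then have "x \<in> insert (pzero F) S" if "x \<in> carrier F" for x
    using g_closed[OF that] that by (auto dest: fun_cong[of _ _ x])
  then have "nonzeros F \<subseteq> S" by (auto simp: nonzeros_def)
  moreover have "S \<subseteq> nonzeros F" using subgroup_closed(1)[OF S] nonzeros_eq_Units by simp
  ultimately show ?thesis
    using cross_ratios_units nonzeros_eq_Units by (simp add: pasture_generated_by_def S_def)
qed

end
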